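(* Let $C\subset\mathbb{R}^d$ be a closed convex set with $\emptyset\subsetneq C\subsetneq\mathbb{R}^d$, let $\boldsymbol{\mu}\in\mathbb{R}^d$ and $\mathbf{g}\sim\mathcal{N}(0,I_d)$. Let $$F=d^2(\mathbf{g}+\boldsymbol{\mu},C)-E[d^2(\mathbf{g}+\boldsymbol{\mu},C)],\qquad\sigma^2=\mathrm{Var}(F),$$ and let $N\sim\mathcal{N}(0,\sigma^2)$. Then $$d_{TV}(F,N)\le\frac{16\sqrt{E\,d^2(\mathbf{g},C-\boldsymbol{\mu})}}{\sigma^2}.$$
   Context: $d(\mathbf{x},C)=\inf_{\mathbf{y}\in C}\|\mathbf{x}-\mathbf{y}\|$ (Euclidean norm), and $d^2(\mathbf{x},C)$ is its square. $C-\boldsymbol{\mu}=\{\mathbf{y}-\boldsymbol{\mu}:\mathbf{y}\in C\}$. The total variation distance is $d_{TV}(F,G)=\sup_A|P(F\in A)-P(G\in A)|$, the supremum running over all Borel sets $A\subset\mathbb{R}$. *)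

theory Defs
  imports "HOL-Probability.Probability"
begin

text \<open>
  \<open>g \<sim> N(0, I_d)\<close>: the law of \<open>g\<close> has Lebesgue density
  \<open>(2 \<pi>) powr (- d/2) * exp (- norm x ^ 2 / 2)\<close>, written as the product of the
  standard normal densities of the coordinates.
\<close>

definition std_gaussian_vector :: "'a measure \<Rightarrow> ('a \<Rightarrow> real ^ 'd) \<Rightarrow> bool" where
  "std_gaussian_vector M g \<longleftrightarrow>
     distributed M lborel g (\<lambda>x. ennreal (\<Prod>i\<in>UNIV. std_normal_density (x $ i)))"

text \<open>
  Only the laws of the two variables matter, so they may live on different probability spaces.
  When these are indeed probability spaces the supremum is taken over a subset of \<open>{0..1}\<close>.
\<close>

definition tv_dist :: "'a measure \<Rightarrow> ('a \<Rightarrow> real) \<Rightarrow> 'b measure \<Rightarrow> ('b \<Rightarrow> real) \<Rightarrow> real" where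
  "tv_dist M F M' G =
     (SUP A\<in>sets borel. \<bar>measure M {\<omega> \<in> space M. F \<omega> \<in> A} - measure M' {\<omega> \<in> space M'. G \<omega> \<in> A}\<bar>)"

end

theory Submission imports Defs begin

text \<open>
Write \<open>R x = x + \<mu> - \<Pi>\<^sub>C (x + \<mu>)\<close>, where \<open>\<Pi>\<^sub>C\<close> is the projection to \<open>C\<close>. Then \<open>R\<close> is the
gradient of half the squared distance \<open>\<psi> x = d\<^sup>2(x + \<mu>, C) / 2\<close>, it is 1-Lipschitz, and
\<open>\<bar>R\<bar>\<^sup>2 = 2 \<psi>\<close>. The bound comes from Stein's method for the functional \<open>F = 2 \<psi> - E (2 \<psi>)\<close>
of a standard Gaussian vector.

Let \<open>x\<close> and \<open>z\<close> be independent standard Gaussian vectors. Moving \<open>x\<close> to \<open>z\<close> along the rotation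
\<open>cos t x + sin t z\<close>, under which the law of the pair is invariant, and integrating by parts gives the
covariance formula \<open>gauss_covariance\<close>. It yields \<open>E [F f(F)] = E [f'(F) 4 T(x)]\<close> with
\<open>T = R \<bullet> V\<close>, where \<open>V x\<close> averages \<open>R (cos t x + sin t z)\<close> over \<open>z\<close> and over the
angle \<open>t\<close> with density \<open>sin\<close> on \<open>[0, \<pi>/2]\<close>. The choice \<open>f y = y\<close> shows that \<open>E (4 T) = \<sigma>\<^sup>2\<close>.
Inserting the solution of Stein's equation, whose derivative is at most 2, bounds the distance by
\<open>(2 / \<sigma>\<^sup>2) E \<bar>\<sigma>\<^sup>2 - 4 T\<bar> \<le> (8 / \<sigma>\<^sup>2) sqrt (Var T)\<close>. Hence the theorem follows from
\<open>Var T \<le> 4 E \<bar>R\<bar>\<^sup>2\<close>, the lemma \<open>T_variance\<close>.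

The usual way to bound \<open>Var T\<close> is the Gaussian Poincare inequality, but the gradient of \<open>T\<close> involves
the derivative of \<open>R\<close>, which exists only almost everywhere. Instead the quarter circle from \<open>x\<close> to
\<open>z\<close> is cut into \<open>n\<close> equal arcs; by rotation invariance all increments of \<open>T\<close> have the
same second moment, so \<open>2 Var T\<close> is at most \<open>n\<^sup>2\<close> times that of a single one. What
remains is to show that the increment of \<open>T\<close> over an arc of length \<open>\<epsilon>\<close> has second moment at most
a constant times \<open>\<epsilon>\<^sup>2 E \<bar>R\<bar>\<^sup>2\<close> with a constant independent of the dimension, up to
\<open>O(\<epsilon>\<^sup>4)\<close>. A Lipschitz bound on \<open>R\<close> alone would lose a factor equal to the dimension. The lemma
\<open>gradient_increment\<close> avoids this with the symmetry of second differences: if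
\<open>U\<close> is the gradient of \<open>\<Psi>\<close>, then \<open>(U (x + \<epsilon> z) - U x) \<bullet> v\<close> and
\<open>(U (x + \<delta> v) - U x) \<bullet> z\<close> are, after division by \<open>\<epsilon>\<close> and by \<open>\<delta>\<close>, both close to averages of
the same second difference of \<open>\<Psi>\<close>; in the second form \<open>z\<close> is a Gaussian vector independent of \<open>x\<close>
and of \<open>v = v x\<close>, so the second moment is
\<open>E \<bar>U (x + \<delta> v) - U x\<bar>\<^sup>2 \<le> \<delta>\<^sup>2 E \<bar>v\<bar>\<^sup>2\<close>.

The resulting constant is \<open>2 * 4 * sqrt (\<pi>\<^sup>2 / 8 * 5 / 2) < 16\<close>, up to factors that can be chosen
arbitrarily close to 1. Finally, \<open>measure_diff_le_continuous_test\<close> passes from continuous test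
functions, for which Stein's equation has a differentiable solution, to indicators of Borel sets.
\<close>

section \<open>Continuous functions of polynomial growth\<close>

text \<open>
All functions that are integrated below are built from Lipschitz maps, inner products, \<open>sin\<close> and \<open>cos\<close>.
Continuity together with polynomial growth is stable under all of these operations and under
composition, and it gives integrability against every measure with finite moments; so
measurability, integrability and Fubini all reduce to the syntactic rules \<open>tame_intros\<close>.
\<close>

definition tame :: "('a::real_normed_vector \<Rightarrow> 'b::real_normed_vector) \<Rightarrow> bool" where
  "tame f \<longleftrightarrow> continuous_on UNIV f \<and> (\<exists>K k. \<forall>x. norm (f x) \<le> K * (1 + norm x) ^ k)"

named_theorems tame_intros

lemma tameI:
  assumes "continuous_on UNIV f" and "\<And>x. norm (f x) \<le> K * (1 + norm x) ^ k"
  shows "tame f"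
  using assms unfolding tame_def by blast

lemma tame_continuous: "tame f \<Longrightarrow> continuous_on S f"
  unfolding tame_def by (meson continuous_on_subset subset_UNIV)

lemma tameE:
  assumes "tame f"
  obtains K k where "0 \<le> K" "\<And>x. norm (f x) \<le> K * (1 + norm x) ^ k"
proof -
  from assms obtain K k where *: "\<And>x. norm (f x) \<le> K * (1 + norm x) ^ k"
    unfolding tame_def by blast
  have "0 \<le> norm (f 0)" by simp
  also have "\<dots> \<le> K" using *[of 0] by simp
  finally show ?thesis using * that by blast
qed

lemma tame_compose:
  assumes "tame f" and "tame g"
  shows "tame (\<lambda>x. f (g x))"
proof -
  obtain K k where K: "0 \<le> K" "\<And>x. norm (f x) \<le> K * (1 + norm x) ^ k" using tameE[OF assms(1)] by blast
  obtain L l where L: "0 \<le> L" "\<And>x. norm (g x) \<le> L * (1 + norm x) ^ l" using tameE[OF assms(2)] by blast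
  have "norm (f (g x)) \<le> (K * (1 + L) ^ k) * (1 + norm x) ^ (l * k)" for x
  proof -
    have "1 + norm (g x) \<le> (1 + norm x) ^ l + L * (1 + norm x) ^ l"
      using L(2)[of x] one_le_power[of "1 + norm x" l] by (smt (verit) norm_ge_zero)
    then have "(1 + norm (g x)) ^ k \<le> ((1 + L) * (1 + norm x) ^ l) ^ k"
      by (intro power_mono) (auto simp: algebra_simps)
    then have "K * (1 + norm (g x)) ^ k \<le> K * ((1 + L) * (1 + norm x) ^ l) ^ k"
      using K(1) by (intro mult_left_mono)
    then show ?thesis using K(2)[of "g x"] by (simp add: power_mult_distrib power_mult mult.assoc)
  qed
  moreover have "continuous_on UNIV (\<lambda>x. f (g x))"
    by (rule continuous_on_compose2[OF tame_continuous[OF assms(1)] tame_continuous[OF assms(2)]])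
       (rule subset_UNIV)
  ultimately show ?thesis by (rule tameI[rotated])
qed

lemma tame_lipschitz:
  assumes "\<And>x y. norm (f x - f y) \<le> L * norm (x - y)"
  shows "tame f"
proof (rule tameI)
  have "0 \<le> \<bar>L\<bar>" by simp
  moreover have "dist (f x) (f y) \<le> \<bar>L\<bar> * dist x y" for x y
    using assms[of x y] by (simp add: dist_norm) (smt (verit) mult_right_mono norm_ge_zero)
  ultimately have "\<bar>L\<bar>-lipschitz_on UNIV f" by (intro lipschitz_onI)
  then show "continuous_on UNIV f" by (rule lipschitz_on_continuous_on)
next
  fix x
  have "norm (f x) \<le> norm (f 0) + norm (f x - f 0)" using norm_triangle_sub by blast
  also have "\<dots> \<le> norm (f 0) + \<bar>L\<bar> * norm x"
    using assms[of x 0] by (simp, smt (verit) mult_right_mono norm_ge_zero)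
  also have "\<dots> \<le> (norm (f 0) + \<bar>L\<bar>) * (1 + norm x) ^ 1"
    by (simp add: algebra_simps)
  finally show "norm (f x) \<le> (norm (f 0) + \<bar>L\<bar>) * (1 + norm x) ^ 1" .
qed

lemma tame_bounded_linear:
  assumes "bounded_linear f"
  shows "tame f"
proof -
  obtain K where K: "\<And>x. norm (f x) \<le> norm x * K"
    using assms bounded_linear.bounded by blast
  show ?thesis
    by (rule tame_lipschitz[of _ K])
       (metis K assms bounded_linear.linear linear_diff mult.commute)
qed

lemma tame_bounded_real:
  fixes f :: "real \<Rightarrow> real"
  assumes "continuous_on UNIV f" "\<And>x. \<bar>f x\<bar> \<le> K"
  shows "tame f"
  by (rule tameI[of _ K 0]) (use assms in auto)

lemma tame_const [tame_intros]: "tame (\<lambda>x. c)"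
  by (rule tame_lipschitz[of _ 0]) simp

lemma tame_ident [tame_intros]: "tame (\<lambda>x. x)"
  by (rule tame_lipschitz[of _ 1]) simp

lemma tame_fst [tame_intros]: "tame f \<Longrightarrow> tame (\<lambda>x. fst (f x))"
  by (rule tame_compose[OF tame_bounded_linear[OF bounded_linear_fst]])

lemma tame_snd [tame_intros]: "tame f \<Longrightarrow> tame (\<lambda>x. snd (f x))"
  by (rule tame_compose[OF tame_bounded_linear[OF bounded_linear_snd]])

lemma tame_Pair [tame_intros]:
  assumes "tame f" "tame g"
  shows "tame (\<lambda>x. (f x, g x))"
proof -
  obtain K k where K: "0 \<le> K" "\<And>x. norm (f x) \<le> K * (1 + norm x) ^ k" using tameE[OF assms(1)] by blast
  obtain L l where L: "0 \<le> L" "\<And>x. norm (g x) \<le> L * (1 + norm x) ^ l" using tameE[OF assms(2)] by blast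
  have "norm (f x, g x) \<le> (K + L) * (1 + norm x) ^ (k + l)" for x
  proof -
    have "norm (f x, g x) \<le> norm (f x) + norm (g x)" by (rule norm_Pair_le)
    also have "\<dots> \<le> K * (1 + norm x) ^ k + L * (1 + norm x) ^ l" using K L by (intro add_mono)
    also have "\<dots> \<le> K * (1 + norm x) ^ (k + l) + L * (1 + norm x) ^ (k + l)"
      using K(1) L(1) by (intro add_mono mult_left_mono power_increasing) auto
    finally show ?thesis by (simp add: distrib_right)
  qed
  moreover have "continuous_on UNIV (\<lambda>x. (f x, g x))"
    using assms by (intro continuous_on_Pair tame_continuous)
  ultimately show ?thesis by (rule tameI[rotated])
qed

lemma tame_bilinear:
  assumes "bounded_bilinear h" "tame f" "tame g"
  shows "tame (\<lambda>x. h (f x) (g x))"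
proof -
  obtain C where C: "0 \<le> C" "\<And>a b. norm (h a b) \<le> norm a * norm b * C"
    using bounded_bilinear.nonneg_bounded[OF assms(1)] by blast
  have "tame (\<lambda>p. h (fst p) (snd p))"
  proof (rule tameI)
    fix p :: "'a \<times> 'b"
    have "norm (h (fst p) (snd p)) \<le> norm (fst p) * norm (snd p) * C" using C by simp
    also have "\<dots> \<le> (1 + norm p) * (1 + norm p) * C"
      using C(1) norm_fst_le[of "fst p" "snd p"] norm_snd_le[of "snd p" "fst p"]
      by (intro mult_right_mono mult_mono) auto
    finally show "norm (h (fst p) (snd p)) \<le> C * (1 + norm p) ^ 2"
      by (simp add: power2_eq_square mult_ac)
  qed (intro bounded_bilinear.continuous_on[OF assms(1)] continuous_intros)
  from tame_compose[OF this tame_Pair[OF assms(2,3)]] show ?thesis by simp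
qed

lemmas tame_mult [tame_intros] = tame_bilinear[OF bounded_bilinear_mult]
lemmas tame_scaleR [tame_intros] = tame_bilinear[OF bounded_bilinear_scaleR]
lemmas tame_inner [tame_intros] = tame_bilinear[OF bounded_bilinear_inner]

lemma tame_add [tame_intros]:
  assumes "tame f" "tame g" shows "tame (\<lambda>x. f x + g x)"
  using tame_compose[OF tame_bounded_linear[OF bounded_linear_add[OF bounded_linear_fst bounded_linear_snd]]
      tame_Pair[OF assms]] by simp

lemma tame_diff [tame_intros]:
  assumes "tame f" "tame g" shows "tame (\<lambda>x. f x - g x)"
  using tame_compose[OF tame_bounded_linear[OF bounded_linear_sub[OF bounded_linear_fst bounded_linear_snd]]
      tame_Pair[OF assms]] by simp

lemma tame_minus [tame_intros]: "tame f \<Longrightarrow> tame (\<lambda>x. - f x)"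
  using tame_diff[OF tame_const[of 0]] by force

lemma tame_norm [tame_intros]: "tame f \<Longrightarrow> tame (\<lambda>x. norm (f x))"
  by (rule tame_compose[OF tame_lipschitz[of norm 1]])
     (metis mult_1 norm_triangle_ineq3 real_norm_def)

lemma tame_abs [tame_intros]: "tame f \<Longrightarrow> tame (\<lambda>x. \<bar>f x :: real\<bar>)"
  using tame_norm[of f] by simp

lemma tame_power [tame_intros]:
  fixes f :: "'a::real_normed_vector \<Rightarrow> real"
  shows "tame f \<Longrightarrow> tame (\<lambda>x. f x ^ n)"
  by (induction n) (auto intro!: tame_intros)

lemma tame_sin [tame_intros]: "tame f \<Longrightarrow> tame (\<lambda>x. sin (f x :: real))"
  by (rule tame_compose[OF tame_bounded_real[where K = 1]]) (auto intro!: continuous_intros)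

lemma tame_cos [tame_intros]: "tame f \<Longrightarrow> tame (\<lambda>x. cos (f x :: real))"
  by (rule tame_compose[OF tame_bounded_real[where K = 1]]) (auto intro!: continuous_intros)

lemma tame_divide [tame_intros]: "tame f \<Longrightarrow> tame (\<lambda>x. f x / c :: real)"
  using tame_mult[of f "\<lambda>x. 1 / c"] by (auto intro!: tame_intros)

section \<open>Finite measures with moments of all orders\<close>

definition moment_measure :: "'a::euclidean_space measure \<Rightarrow> bool" where
  "moment_measure M \<longleftrightarrow>
     finite_measure M \<and> sets M = sets borel \<and> (\<forall>k. integrable M (\<lambda>x. norm x ^ k))"

lemma moment_measureD:
  assumes "moment_measure M"
  shows "finite_measure M" "sets M = sets borel" "integrable M (\<lambda>x. norm x ^ k)"
  using assms unfolding moment_measure_def by auto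

lemma tame_measurable:
  assumes "moment_measure M" "tame f"
  shows "f \<in> borel_measurable M"
  using borel_measurable_continuous_onI[OF tame_continuous[OF assms(2)]] moment_measureD(2)[OF assms(1)]
  by (simp cong: measurable_cong_sets)

lemma add_power_le:
  fixes a b :: real
  assumes "0 \<le> a" "0 \<le> b"
  shows "(a + b) ^ k \<le> 2 ^ k * (a ^ k + b ^ k)"
proof -
  have "(a + b) ^ k \<le> (2 * max a b) ^ k" using assms by (intro power_mono) auto
  also have "\<dots> = 2 ^ k * (max a b) ^ k" by (simp add: power_mult_distrib)
  also have "\<dots> \<le> 2 ^ k * (a ^ k + b ^ k)" using assms by (auto simp: max_def)
  finally show ?thesis .
qed

lemma tame_integrable:
  fixes f :: "'a::euclidean_space \<Rightarrow> 'b::euclidean_space"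
  assumes M: "moment_measure M" and f: "tame f"
  shows "integrable M f"
proof -
  interpret finite_measure M by (rule moment_measureD[OF M])
  obtain K k where K: "0 \<le> K" "\<And>x. norm (f x) \<le> K * (1 + norm x) ^ k" using tameE[OF f] by blast
  have "integrable M (\<lambda>x. K * (2 ^ k * (1 + norm x ^ k)))"
    using moment_measureD(3)[OF M, of k] by simp
  then show ?thesis
  proof (rule Bochner_Integration.integrable_bound)
    show "f \<in> borel_measurable M" by (rule tame_measurable[OF M f])
    show "AE x in M. norm (f x) \<le> norm (K * (2 ^ k * (1 + norm x ^ k)))"
    proof (rule AE_I2)
      fix x
      have "norm (f x) \<le> K * (1 + norm x) ^ k" by (rule K)
      also have "\<dots> \<le> K * (2 ^ k * (1 + norm x ^ k))"
        using add_power_le[of 1 "norm x" k] K(1) by (intro mult_left_mono) auto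
      finally show "norm (f x) \<le> norm (K * (2 ^ k * (1 + norm x ^ k)))" by simp
    qed
  qed
qed

lemma moment_measure_pair:
  assumes M: "moment_measure M" and N: "moment_measure N"
  shows "moment_measure (M \<Otimes>\<^sub>M N)"
proof -
  interpret M: finite_measure M by (rule moment_measureD[OF M])
  interpret N: finite_measure N by (rule moment_measureD[OF N])
  interpret MN: pair_sigma_finite M N ..
  have S: "sets (M \<Otimes>\<^sub>M N) = sets borel"
    using sets_pair_measure_cong[OF moment_measureD(2)[OF M] moment_measureD(2)[OF N]]
    by (simp only: borel_prod)
  have fin: "finite_measure (M \<Otimes>\<^sub>M N)" by (intro finite_measure_pair_measure M.finite_measure_axioms N.finite_measure_axioms)
  have 1: "integrable (M \<Otimes>\<^sub>M N) (\<lambda>p. norm (fst p) ^ k)" for k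
  proof (rule MN.Fubini_integrable)
    show "(\<lambda>p. norm (fst p) ^ k) \<in> borel_measurable (M \<Otimes>\<^sub>M N)"
      unfolding measurable_cong_sets[OF S refl]
      by (intro borel_measurable_continuous_onI continuous_intros)
  qed (use moment_measureD(3)[OF M, of k] in \<open>auto\<close>)
  have 2: "integrable (M \<Otimes>\<^sub>M N) (\<lambda>p. norm (snd p) ^ k)" for k
  proof (rule MN.Fubini_integrable)
    show "(\<lambda>p. norm (snd p) ^ k) \<in> borel_measurable (M \<Otimes>\<^sub>M N)"
      unfolding measurable_cong_sets[OF S refl]
      by (intro borel_measurable_continuous_onI continuous_intros)
  qed (use moment_measureD(3)[OF N, of k] in \<open>auto\<close>)
  have "integrable (M \<Otimes>\<^sub>M N) (\<lambda>p. norm p ^ k)" for k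
  proof (rule Bochner_Integration.integrable_bound)
    show "integrable (M \<Otimes>\<^sub>M N) (\<lambda>p. 2 ^ k * (norm (fst p) ^ k + norm (snd p) ^ k))"
      using 1[of k] 2[of k] by simp
    show "(\<lambda>p. norm p ^ k) \<in> borel_measurable (M \<Otimes>\<^sub>M N)"
      unfolding measurable_cong_sets[OF S refl]
      by (intro borel_measurable_continuous_onI continuous_intros)
    have "norm p ^ k \<le> 2 ^ k * (norm (fst p) ^ k + norm (snd p) ^ k)" for p :: "'a \<times> 'b"
      using power_mono[OF norm_Pair_le[of "fst p" "snd p"], of k]
        add_power_le[of "norm (fst p)" "norm (snd p)" k] by simp
    then show "AE p in M \<Otimes>\<^sub>M N. norm (norm p ^ k) \<le> norm (2 ^ k * (norm (fst p) ^ k + norm (snd p) ^ k))"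
      by (intro AE_I2) simp
  qed
  then show ?thesis using fin S unfolding moment_measure_def by auto
qed

lemma tame_Fubini:
  fixes f :: "'a::euclidean_space \<times> 'b::euclidean_space \<Rightarrow> 'c::euclidean_space"
  assumes M: "moment_measure M" and N: "moment_measure N" and f: "tame f"
  shows "integrable M (\<lambda>x. \<integral>y. f (x, y) \<partial>N)"
    and "integrable N (\<lambda>y. \<integral>x. f (x, y) \<partial>M)"
    and "(\<integral>x. (\<integral>y. f (x, y) \<partial>N) \<partial>M) = (\<integral>p. f p \<partial>(M \<Otimes>\<^sub>M N))"
    and "(\<integral>y. (\<integral>x. f (x, y) \<partial>M) \<partial>N) = (\<integral>p. f p \<partial>(M \<Otimes>\<^sub>M N))"
proof -
  interpret M: finite_measure M by (rule moment_measureD[OF M])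
  interpret N: finite_measure N by (rule moment_measureD[OF N])
  interpret MN: pair_sigma_finite M N ..
  have "integrable (M \<Otimes>\<^sub>M N) f" by (rule tame_integrable[OF moment_measure_pair[OF M N] f])
  then have *: "integrable (M \<Otimes>\<^sub>M N) (case_prod (\<lambda>x y. f (x, y)))" by simp
  show "integrable M (\<lambda>x. \<integral>y. f (x, y) \<partial>N)" "integrable N (\<lambda>y. \<integral>x. f (x, y) \<partial>M)"
    "(\<integral>x. (\<integral>y. f (x, y) \<partial>N) \<partial>M) = (\<integral>p. f p \<partial>(M \<Otimes>\<^sub>M N))"
    "(\<integral>y. (\<integral>x. f (x, y) \<partial>M) \<partial>N) = (\<integral>p. f p \<partial>(M \<Otimes>\<^sub>M N))"
    using MN.integrable_fst[OF *] MN.integrable_snd[OF *] MN.integral_fst[OF *] MN.integral_snd[OF *] by auto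
qed

section \<open>The standard Gaussian measure\<close>

definition gauss_density :: "'a::euclidean_space \<Rightarrow> real" where
  "gauss_density x = (1 / sqrt (2 * pi)) ^ DIM('a) * exp (- (norm x)\<^sup>2 / 2)"

definition gauss :: "'a::euclidean_space measure" where
  "gauss = density lborel (\<lambda>x. ennreal (gauss_density x))"

text \<open>
The radial form of the density makes rotation invariance evident; this product form gives the
total mass and the moments by integrating over one coordinate at a time.
\<close>

lemma gauss_density_eq_prod:
  "gauss_density x = (\<Prod>b\<in>Basis. std_normal_density (x \<bullet> b))"
proof -
  have "(norm x)\<^sup>2 = (\<Sum>b\<in>Basis. (x \<bullet> b)\<^sup>2)"
    by (subst power2_norm_eq_inner, subst euclidean_inner) (simp add: power2_eq_square)
  then have "exp (- (norm x)\<^sup>2 / 2) = (\<Prod>b\<in>Basis. exp (- (x \<bullet> b)\<^sup>2 / 2))"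
    by (simp add: exp_sum[symmetric] sum_negf sum_divide_distrib)
  then show ?thesis
    by (simp only: gauss_density_def std_normal_density_def prod.distrib prod_constant)
qed

lemma gauss_density_nonneg [simp]: "0 \<le> gauss_density x"
  by (simp add: gauss_density_def)

lemma continuous_gauss_density: "continuous_on S gauss_density"
  unfolding gauss_density_def by (intro continuous_intros) auto

lemma measurable_gauss_density [measurable]: "gauss_density \<in> borel_measurable borel"
  by (rule borel_measurable_continuous_onI[OF continuous_gauss_density])

lemma sets_gauss [simp, measurable_cong]: "sets gauss = sets borel"
  by (simp add: gauss_def)

lemma space_gauss [simp]: "space gauss = UNIV"
  by (simp add: gauss_def)

lemma emeasure_gauss: "emeasure gauss (space gauss) = 1"
proof -
  have "emeasure (gauss :: 'a measure) (space gauss) = (\<integral>\<^sup>+x. ennreal (gauss_density (x::'a)) \<partial>lborel)"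
    by (simp add: gauss_def emeasure_density)
  also have "\<dots> = (\<integral>\<^sup>+x. (\<Prod>b\<in>Basis. ennreal (std_normal_density ((x::'a) \<bullet> b))) \<partial>lborel)"
    by (simp add: gauss_density_eq_prod prod_ennreal)
  also have "\<dots> = (\<Prod>b\<in>(Basis::'a set). (\<integral>\<^sup>+x. ennreal (std_normal_density x) \<partial>lborel))"
    by (rule nn_integral_lborel_prod) auto
  also have "\<dots> = 1"
    using prob_space.emeasure_space_1[OF prob_space_normal_density[of 1 0]]
    by (simp add: emeasure_density)
  finally show ?thesis .
qed

lemma prob_space_gauss: "prob_space gauss"
  by (rule prob_spaceI) (rule emeasure_gauss)

lemma integral_gauss:
  fixes f :: "'a::euclidean_space \<Rightarrow> 'b::euclidean_space"
  assumes "f \<in> borel_measurable borel"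
  shows "(\<integral>x. f x \<partial>gauss) = (\<integral>x. gauss_density x *\<^sub>R f x \<partial>lborel)"
  unfolding gauss_def using assms by (intro integral_density) auto

lemma integrable_gauss_iff:
  fixes f :: "'a::euclidean_space \<Rightarrow> 'b::euclidean_space"
  assumes "f \<in> borel_measurable borel"
  shows "integrable gauss f \<longleftrightarrow> integrable lborel (\<lambda>x. gauss_density x *\<^sub>R f x)"
  unfolding gauss_def using assms by (intro integrable_density) auto

lemma integrable_gauss_coord:
  assumes b: "b \<in> (Basis :: 'a::euclidean_space set)"
  shows "integrable gauss (\<lambda>x. \<bar>x \<bullet> b\<bar> ^ k)"
proof (rule integrableI_bounded)
  let ?f = "\<lambda>c t. ennreal (std_normal_density t * (if c = b then \<bar>t\<bar> ^ k else 1))"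
  have fin: "(\<integral>\<^sup>+t. ?f c t \<partial>lborel) < \<infinity>" for c
  proof (cases "c = b")
    case True
    then show ?thesis
      using integrable_std_normal_moment_abs[of k]
      by (auto simp: integrable_iff_bounded abs_mult)
  next
    case False
    then show ?thesis
      using prob_space.emeasure_space_1[OF prob_space_normal_density[of 1 0]]
      by (simp add: emeasure_density)
  qed
  have "(\<integral>\<^sup>+x. ennreal (norm (\<bar>x \<bullet> b\<bar> ^ k)) \<partial>gauss)
      = (\<integral>\<^sup>+x. ennreal (gauss_density (x::'a)) * ennreal (\<bar>x \<bullet> b\<bar> ^ k) \<partial>lborel)"
    unfolding gauss_def by (subst nn_integral_density) auto
  also have "\<dots> = (\<integral>\<^sup>+x. (\<Prod>c\<in>Basis. ?f c ((x::'a) \<bullet> c)) \<partial>lborel)"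
  proof (rule nn_integral_cong)
    fix x :: 'a
    have "(\<Prod>c\<in>Basis. ?f c (x \<bullet> c)) = ennreal (\<Prod>c\<in>Basis. std_normal_density (x \<bullet> c) * (if c = b then \<bar>x \<bullet> c\<bar> ^ k else 1))"
      by (rule prod_ennreal) auto
    also have "\<dots> = ennreal (gauss_density x * \<bar>x \<bullet> b\<bar> ^ k)"
      using b by (simp add: prod.distrib gauss_density_eq_prod prod.delta)
    finally show "ennreal (gauss_density x) * ennreal (\<bar>x \<bullet> b\<bar> ^ k) = (\<Prod>c\<in>Basis. ?f c (x \<bullet> c))"
      by (simp add: ennreal_mult)
  qed
  also have "\<dots> = (\<Prod>c\<in>Basis. (\<integral>\<^sup>+t. ?f c t \<partial>lborel))"
    by (rule nn_integral_lborel_prod) auto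
  also have "\<dots> < \<infinity>"
    using fin by (simp add: ennreal_prod_eq_top less_top[symmetric])
  finally show "(\<integral>\<^sup>+x. ennreal (norm (\<bar>x \<bullet> b\<bar> ^ k)) \<partial>gauss) < \<infinity>" .
qed simp

lemma moment_measure_gauss: "moment_measure (gauss :: 'a::euclidean_space measure)"
proof -
  interpret prob_space "gauss :: 'a measure" by (rule prob_space_gauss)
  have "integrable gauss (\<lambda>x::'a. norm x ^ k)" for k
  proof (rule Bochner_Integration.integrable_bound)
    show "integrable gauss (\<lambda>x::'a. real DIM('a) ^ k * (\<Sum>b\<in>Basis. \<bar>x \<bullet> b\<bar> ^ k))"
      by (auto intro!: Bochner_Integration.integrable_sum integrable_gauss_coord)
    show "AE x::'a in gauss. norm (norm x ^ k) \<le> norm (real DIM('a) ^ k * (\<Sum>b\<in>Basis. \<bar>x \<bullet> b\<bar> ^ k))"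
    proof (rule AE_I2)
      fix x :: 'a
      \<comment> \<open>The norm is at most the dimension times the largest coordinate.\<close>
      define m where "m = Max ((\<lambda>b. \<bar>x \<bullet> b\<bar>) ` Basis)"
      have m: "\<bar>x \<bullet> b\<bar> \<le> m" if "b \<in> Basis" for b
        unfolding m_def using that by (intro Max_ge) auto
      have "m \<in> (\<lambda>b. \<bar>x \<bullet> b\<bar>) ` Basis" unfolding m_def by (intro Max_in) auto
      then obtain c where c: "c \<in> Basis" "m = \<bar>x \<bullet> c\<bar>" by auto
      have "norm x \<le> (\<Sum>b\<in>Basis. \<bar>x \<bullet> b\<bar>)" by (rule norm_le_l1)
      also have "\<dots> \<le> real DIM('a) * m"
        using sum_bounded_above[of Basis "\<lambda>b. \<bar>x \<bullet> b\<bar>" m] m by simp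
      finally have "norm x ^ k \<le> (real DIM('a) * m) ^ k" by (intro power_mono) auto
      also have "\<dots> = real DIM('a) ^ k * m ^ k" by (simp add: power_mult_distrib)
      also have "m ^ k \<le> (\<Sum>b\<in>Basis. \<bar>x \<bullet> b\<bar> ^ k)"
        unfolding c(2) using c(1) by (intro member_le_sum) auto
      finally have "norm x ^ k \<le> real DIM('a) ^ k * (\<Sum>b\<in>Basis. \<bar>x \<bullet> b\<bar> ^ k)"
        by (simp add: mult_left_mono)
      then show "norm (norm x ^ k) \<le> norm (real DIM('a) ^ k * (\<Sum>b\<in>Basis. \<bar>x \<bullet> b\<bar> ^ k))"
        by (smt (verit) norm_ge_zero real_norm_def zero_le_power)
    qed
  qed simp
  then show ?thesis
    using finite_measure_axioms unfolding moment_measure_def by simp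
qed

section \<open>Rotation invariance\<close>

abbreviation gauss2 :: "('a::euclidean_space \<times> 'a) measure" where
  "gauss2 \<equiv> gauss \<Otimes>\<^sub>M gauss"

lemma moment_measure_gauss2: "moment_measure gauss2"
  by (intro moment_measure_pair moment_measure_gauss)

text \<open>
The rotation acts on the two components of a pair, not on the underlying space: \<open>fst (rot t p)\<close> runs
along an arc from \<open>fst p\<close> to \<open>snd p\<close>, and \<open>snd (rot t p)\<close> is its velocity.
\<close>

definition rot :: "real \<Rightarrow> 'a::euclidean_space \<times> 'a \<Rightarrow> 'a \<times> 'a" where
  "rot t p = (cos t *\<^sub>R fst p + sin t *\<^sub>R snd p, cos t *\<^sub>R snd p - sin t *\<^sub>R fst p)"

lemma gauss2_eq_density:
  "gauss2 = density lborel (\<lambda>p :: 'a::euclidean_space \<times> 'a. ennreal (gauss_density (fst p) * gauss_density (snd p)))"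
proof -
  interpret prob_space "gauss :: 'a measure" by (rule prob_space_gauss)
  have "gauss2 = density (lborel \<Otimes>\<^sub>M lborel)
      (\<lambda>(x, y). ennreal (gauss_density (x::'a)) * ennreal (gauss_density (y::'a)))"
    unfolding gauss_def
    by (rule pair_measure_density)
       (use sigma_finite_lborel sigma_finite_measure_axioms in \<open>auto simp: gauss_def\<close>)
  then show ?thesis by (simp add: lborel_prod case_prod_beta' ennreal_mult)
qed

text \<open>
For a fixed second component a shear is a translation.
\<close>

lemma distr_lborel_shear_fst:
  "distr (lborel :: ('a::euclidean_space \<times> 'a) measure) borel (\<lambda>p. (fst p + a *\<^sub>R snd p, snd p)) = lborel"
proof (rule measure_eqI)
  fix A assume "A \<in> sets (distr (lborel :: ('a \<times> 'a) measure) borel (\<lambda>p. (fst p + a *\<^sub>R snd p, snd p)))"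
  then have A [measurable]: "A \<in> sets borel" by simp
  then have [measurable]: "A \<in> sets (borel \<Otimes>\<^sub>M borel)" by (simp only: borel_prod)
  have "emeasure (distr (lborel :: ('a \<times> 'a) measure) borel (\<lambda>p. (fst p + a *\<^sub>R snd p, snd p))) A
      = (\<integral>\<^sup>+p. indicator A (fst p + a *\<^sub>R snd p, snd p) \<partial>(lborel :: ('a \<times> 'a) measure))"
    (is "_ = ?R")
  proof -
    have m: "(\<lambda>p :: 'a \<times> 'a. (fst p + a *\<^sub>R snd p, snd p)) \<in> borel_measurable borel"
      by (intro borel_measurable_continuous_onI continuous_intros)
    have "emeasure (distr (lborel :: ('a \<times> 'a) measure) borel (\<lambda>p. (fst p + a *\<^sub>R snd p, snd p))) A
      = (\<integral>\<^sup>+p. indicator A p \<partial>(distr (lborel :: ('a \<times> 'a) measure) borel (\<lambda>p. (fst p + a *\<^sub>R snd p, snd p))))"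
      by (simp add: A)
    also have "\<dots> = ?R" using m by (subst nn_integral_distr) auto
    finally show ?thesis .
  qed
  also have "\<dots> = (\<integral>\<^sup>+y. \<integral>\<^sup>+x. indicator A (x + a *\<^sub>R y, y) \<partial>(lborel :: 'a measure) \<partial>(lborel :: 'a measure))"
    unfolding lborel_prod[symmetric]
    by (subst lborel_pair.nn_integral_snd[symmetric]) auto
  also have "\<dots> = (\<integral>\<^sup>+y. \<integral>\<^sup>+x. indicator A (x, y) \<partial>(lborel :: 'a measure) \<partial>(lborel :: 'a measure))"
  proof (rule nn_integral_cong)
    fix y :: 'a
    have "(\<integral>\<^sup>+x. indicator A (x, y) \<partial>(lborel :: 'a measure))
        = (\<integral>\<^sup>+x. indicator A (x, y) \<partial>(distr lborel borel ((+) (a *\<^sub>R y))))"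
      by (simp add: lborel_distr_plus)
    also have "\<dots> = (\<integral>\<^sup>+x. indicator A (x + a *\<^sub>R y, y) \<partial>(lborel :: 'a measure))"
      by (subst nn_integral_distr) (auto simp: add.commute)
    finally show "(\<integral>\<^sup>+x. indicator A (x + a *\<^sub>R y, y) \<partial>(lborel :: 'a measure))
        = (\<integral>\<^sup>+x. indicator A (x, y) \<partial>(lborel :: 'a measure))" ..
  qed
  also have "\<dots> = (\<integral>\<^sup>+p. indicator A p \<partial>(lborel :: ('a \<times> 'a) measure))"
    unfolding lborel_prod[symmetric]
    by (subst lborel_pair.nn_integral_snd[symmetric]) auto
  finally show "emeasure (distr (lborel :: ('a \<times> 'a) measure) borel (\<lambda>p. (fst p + a *\<^sub>R snd p, snd p))) A = emeasure lborel A"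
    by simp
qed simp

lemma distr_lborel_swap:
  "distr (lborel :: ('a::euclidean_space \<times> 'a) measure) borel (\<lambda>p. (snd p, fst p)) = lborel"
proof -
  have "(lborel :: ('a \<times> 'a) measure) = distr (lborel \<Otimes>\<^sub>M lborel) (lborel \<Otimes>\<^sub>M lborel) (\<lambda>(x, y). (y, x))"
    unfolding lborel_prod[symmetric] by (rule lborel_pair.distr_pair_swap)
  also have "\<dots> = distr lborel borel (\<lambda>p. (snd p, fst p))"
    by (rule distr_cong) (simp_all only: lborel_prod sets_lborel, auto)
  finally show ?thesis ..
qed

lemma distr_lborel_shear_snd:
  "distr (lborel :: ('a::euclidean_space \<times> 'a) measure) borel (\<lambda>p. (fst p, snd p + a *\<^sub>R fst p)) = lborel"
    (is "?L = _")
proof -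
  let ?s = "\<lambda>p :: 'a \<times> 'a. (snd p, fst p)"
  have "?L = distr (distr (distr lborel borel ?s) borel (\<lambda>p. (fst p + a *\<^sub>R snd p, snd p))) borel ?s"
  proof -
    have [measurable]: "?s \<in> borel_measurable borel" "(\<lambda>p :: 'a \<times> 'a. (fst p + a *\<^sub>R snd p, snd p)) \<in> borel_measurable borel"
        "(\<lambda>p :: 'a \<times> 'a. (snd p + a *\<^sub>R fst p, fst p)) \<in> borel_measurable borel"
      by (intro borel_measurable_continuous_onI continuous_intros)+
    show ?thesis by (simp add: distr_distr o_def)
  qed
  then show ?thesis by (simp add: distr_lborel_swap distr_lborel_shear_fst)
qed

lemma measurable_rot [measurable]: "rot t \<in> borel_measurable borel"
  unfolding rot_def by (intro borel_measurable_continuous_onI continuous_intros)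

text \<open>
A rotation with \<open>cos t \<noteq> -1\<close> is a product of three shears, each of which preserves Lebesgue measure.
\<close>

lemma distr_lborel_rot:
  assumes "cos t \<noteq> -1"
  shows "distr (lborel :: ('a::euclidean_space \<times> 'a) measure) borel (rot t) = lborel"
proof -
  define a where "a = sin t / (1 + cos t)"
  define S where "S = (\<lambda>p :: 'a \<times> 'a. (fst p + a *\<^sub>R snd p, snd p))"
  define S' where "S' = (\<lambda>p :: 'a \<times> 'a. (fst p, snd p + (- sin t) *\<^sub>R fst p))"
  have n: "1 + cos t \<noteq> 0" using assms by linarith
  have 1: "1 - sin t * a = cos t"
  proof -
    have "sin t * sin t = (1 - cos t) * (1 + cos t)"
      using sin_squared_eq[of t] by (simp add: power2_eq_square algebra_simps)
    then show ?thesis using n by (simp add: a_def)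
  qed
  have 2: "a + a * cos t = sin t"
  proof -
    have "a * (1 + cos t) = sin t" using n by (simp add: a_def)
    then show ?thesis by (simp add: distrib_left)
  qed
  have rot: "rot t = S \<circ> S' \<circ> S"
  proof
    fix p :: "'a \<times> 'a"
    obtain x y where p: "p = (x, y)" by (cases p)
    have "(x + a *\<^sub>R y) + a *\<^sub>R (y + (- sin t) *\<^sub>R (x + a *\<^sub>R y)) = (1 - sin t * a) *\<^sub>R x + (a + a * (1 - sin t * a)) *\<^sub>R y"
      by (simp add: algebra_simps scaleR_2 flip: scaleR_add_left)
    moreover have "y + (- sin t) *\<^sub>R (x + a *\<^sub>R y) = (1 - sin t * a) *\<^sub>R y - sin t *\<^sub>R x"
      by (simp add: algebra_simps)
    ultimately show "rot t p = (S \<circ> S' \<circ> S) p"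
      unfolding p by (simp add: rot_def S_def S'_def 1 2)
  qed
  have [measurable]: "S \<in> borel_measurable borel" "S' \<in> borel_measurable borel"
    unfolding S_def S'_def by (intro borel_measurable_continuous_onI continuous_intros)+
  have "distr lborel borel (rot t) = distr (distr (distr lborel borel S) borel S') borel S"
    unfolding rot by (simp add: distr_distr o_assoc)
  then show ?thesis
    by (simp only: S_def S'_def distr_lborel_shear_fst distr_lborel_shear_snd)
qed

lemma norm_rot: "(norm (fst (rot t p)))\<^sup>2 + (norm (snd (rot t p)))\<^sup>2 = (norm (fst p))\<^sup>2 + (norm (snd p))\<^sup>2"
proof -
  have "(norm (c *\<^sub>R x + s *\<^sub>R y))\<^sup>2 + (norm (c *\<^sub>R y - s *\<^sub>R x))\<^sup>2
      = (c\<^sup>2 + s\<^sup>2) * ((norm x)\<^sup>2 + (norm y)\<^sup>2)" for c s and x y :: 'a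
    unfolding power2_norm_eq_inner
    by (simp add: inner_simps inner_commute algebra_simps power2_eq_square)
  from this[of "cos t" "fst p" "sin t" "snd p"] show ?thesis by (simp add: rot_def)
qed

lemma distr_gauss2_rot:
  assumes "cos t \<noteq> -1"
  shows "distr gauss2 borel (rot t) = (gauss2 :: ('a::euclidean_space \<times> 'a) measure)"
proof -
  let ?D = "\<lambda>p :: 'a \<times> 'a. ennreal (gauss_density (fst p) * gauss_density (snd p))"
  have D: "?D (rot t p) = ?D p" for p
  proof -
    have *: "gauss_density (fst q) * gauss_density (snd q)
      = ((1 / sqrt (2 * pi)) ^ DIM('a)) * ((1 / sqrt (2 * pi)) ^ DIM('a)) * exp (- ((norm (fst q))\<^sup>2 + (norm (snd q))\<^sup>2) / 2)" for q :: "'a \<times> 'a"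
      by (simp add: gauss_density_def exp_add[symmetric] add_divide_distrib)
    show ?thesis by (simp only: * norm_rot)
  qed
  have "continuous_on UNIV (\<lambda>p :: 'a \<times> 'a. gauss_density (fst p) * gauss_density (snd p))"
    unfolding gauss_density_def by (intro continuous_intros) auto
  note m [measurable] = borel_measurable_continuous_onI[OF this]
  have "distr gauss2 borel (rot t) = distr (density lborel (\<lambda>p. ?D (rot t p))) borel (rot t)"
    by (simp only: D gauss2_eq_density)
  also have "\<dots> = density (distr lborel borel (rot t)) ?D"
    by (rule density_distr[symmetric]) auto
  also have "\<dots> = gauss2"
    by (simp only: distr_lborel_rot[OF assms] gauss2_eq_density)
  finally show ?thesis .
qed

lemma sets_gauss2: "sets (gauss2 :: ('a::euclidean_space \<times> 'a) measure) = sets borel"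
  by (rule moment_measureD(2)[OF moment_measure_gauss2])

lemma integral_rot:
  fixes f :: "'a::euclidean_space \<times> 'a \<Rightarrow> real"
  assumes "tame f" and "cos t \<noteq> -1"
  shows "(\<integral>p. f (rot t p) \<partial>gauss2) = (\<integral>p. f p \<partial>gauss2)"
proof -
  have "(\<integral>p. f p \<partial>gauss2) = (\<integral>p. f p \<partial>(distr gauss2 borel (rot t)))"
    by (simp add: distr_gauss2_rot[OF assms(2)])
  also have "\<dots> = (\<integral>p. f (rot t p) \<partial>gauss2)"
  proof (rule integral_distr)
    show "rot t \<in> measurable gauss2 borel"
      using measurable_rot by (simp add: measurable_cong_sets[OF sets_gauss2 refl])
    show "f \<in> borel_measurable borel"
      by (rule borel_measurable_continuous_onI[OF tame_continuous[OF assms(1)]])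
  qed
  finally show ?thesis ..
qed

section \<open>Integration by parts\<close>

lemma integral_lborel_shift:
  fixes f :: "'a::euclidean_space \<Rightarrow> real"
  assumes [measurable]: "f \<in> borel_measurable borel"
  shows "(\<integral>x. f (c + x) \<partial>lborel) = (\<integral>x. f x \<partial>lborel)"
proof -
  have "(\<integral>x. f x \<partial>lborel) = (\<integral>x. f x \<partial>(distr lborel borel ((+) c)))" by (simp add: lborel_distr_plus)
  also have "\<dots> = (\<integral>x. f (c + x) \<partial>lborel)" by (rule integral_distr) auto
  finally show ?thesis ..
qed

lemma integrable_lborel_shift:
  fixes f :: "'a::euclidean_space \<Rightarrow> real"
  assumes "integrable lborel f"
  shows "integrable lborel (\<lambda>x. f (c + x))"
proof -
  have [measurable]: "f \<in> borel_measurable borel" using assms by auto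
  have "integrable (distr lborel borel ((+) c)) f" using assms by (simp add: lborel_distr_plus)
  then show ?thesis by (subst (asm) integrable_distr_eq) auto
qed

lemma has_real_derivative_along:
  assumes "(\<phi> has_derivative (\<lambda>h. D \<bullet> h)) (at (p t))"
    and "(p has_vector_derivative p') (at t)"
  shows "((\<lambda>t. \<phi> (p t)) has_real_derivative (D \<bullet> p')) (at t)"
proof -
  have "(p has_derivative (\<lambda>h. h *\<^sub>R p')) (at t)"
    using assms(2) by (simp add: has_vector_derivative_def)
  from has_derivative_compose[OF this assms(1)]
  show ?thesis by (rule has_derivative_imp_has_field_derivative) simp
qed

lemma gauss_density_has_derivative:
  "(gauss_density has_derivative (\<lambda>h. (- gauss_density x *\<^sub>R x) \<bullet> h)) (at x)"
proof -
  have "(gauss_density has_derivative (\<lambda>h. ((1 / sqrt (2 * pi)) ^ DIM('a)) * (exp (- (x \<bullet> x) / 2) * (- (2 * (x \<bullet> h)) / 2)))) (at x)"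
    unfolding gauss_density_def power2_norm_eq_inner
    by (auto intro!: derivative_eq_intros simp: inner_commute)
  then show ?thesis
    by (simp add: gauss_density_def power2_norm_eq_inner mult.assoc)
qed

text \<open>
The derivative of \<open>gauss_density * \<phi>\<close> in direction \<open>w\<close> is \<open>q = gauss_density * (D \<bullet> w - \<phi> * (x \<bullet> w))\<close>.
Integrating \<open>q\<close> along the segment from \<open>x\<close> to \<open>w + x\<close> gives a difference of two translates, which
integrates to zero over the whole space; by Fubini and translation invariance the same double
integral equals the integral of \<open>q\<close>.
\<close>

lemma gauss_integration_by_parts:
  fixes \<phi> :: "'a::euclidean_space \<Rightarrow> real" and D :: "'a \<Rightarrow> 'a"
  assumes der: "\<And>x. (\<phi> has_derivative (\<lambda>h. D x \<bullet> h)) (at x)"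
    and [tame_intros]: "tame \<phi>" "tame D"
  shows "(\<integral>z. \<phi> z * (w \<bullet> z) \<partial>gauss) = (\<integral>z. w \<bullet> D z \<partial>gauss)"
proof -
  define u where "u = (\<lambda>x. D x \<bullet> w - \<phi> x * (x \<bullet> w))"
  define q where "q = (\<lambda>x. gauss_density x * u x)"
  define \<Phi> where "\<Phi> = (\<lambda>x. gauss_density x * \<phi> x)"
  have tu: "tame u" unfolding u_def by (intro tame_intros)
  have cont: "continuous_on UNIV q" "continuous_on UNIV \<Phi>"
    unfolding q_def \<Phi>_def
    by (intro continuous_on_mult continuous_gauss_density tame_continuous[OF tu] tame_continuous[OF assms(2)])+
  note qm [measurable] = borel_measurable_continuous_onI[OF cont(1)]
  have int: "integrable lborel q" "integrable lborel \<Phi>"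
    using tame_integrable[OF moment_measure_gauss tu] tame_integrable[OF moment_measure_gauss assms(2)]
      borel_measurable_continuous_onI[OF tame_continuous[OF tu]]
      borel_measurable_continuous_onI[OF tame_continuous[OF assms(2)]]
    by (simp_all add: integrable_gauss_iff q_def \<Phi>_def)
  let ?I = "\<lambda>t. indicator {0..1::real} t :: real"
  let ?f = "\<lambda>(t, x). ?I t * q (t *\<^sub>R w + x)"
  have ftc: "(\<integral>t. ?I t * q (t *\<^sub>R w + x) \<partial>lborel) = \<Phi> (w + x) - \<Phi> x" for x
  proof -
    have d: "((\<lambda>t. \<Phi> (t *\<^sub>R w + x)) has_real_derivative q (t *\<^sub>R w + x)) (at t)" for t
    proof -
      let ?y = "t *\<^sub>R w + x"
      have p: "((\<lambda>t. t *\<^sub>R w + x) has_vector_derivative w) (at t)"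
        by (auto intro!: derivative_eq_intros)
      have "((\<lambda>t. \<Phi> (t *\<^sub>R w + x)) has_real_derivative
         (((- gauss_density ?y *\<^sub>R ?y) \<bullet> w) * \<phi> ?y + (D ?y \<bullet> w) * gauss_density ?y)) (at t)"
        unfolding \<Phi>_def
        by (rule DERIV_mult[OF has_real_derivative_along[OF gauss_density_has_derivative p]
              has_real_derivative_along[OF der p]])
      then show ?thesis by (simp add: q_def u_def algebra_simps)
    qed
    have "(\<integral>t. q (t *\<^sub>R w + x) * indicator {0..1} t \<partial>lborel) = \<Phi> (1 *\<^sub>R w + x) - \<Phi> (0 *\<^sub>R w + x)"
    proof (rule integral_FTC_Icc_real)
      fix t :: real
      have "continuous_on UNIV (\<lambda>t. q (t *\<^sub>R w + x))"
        by (intro continuous_on_compose2[OF cont(1)] continuous_intros) auto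
      then show "isCont (\<lambda>t. q (t *\<^sub>R w + x)) t" by (simp add: continuous_on_eq_continuous_at)
    qed (use d in auto)
    then show ?thesis by (simp add: mult.commute)
  qed
  have fm: "?f \<in> borel_measurable (lborel \<Otimes>\<^sub>M lborel)"
  proof -
    have "continuous_on UNIV (\<lambda>p. q (fst p *\<^sub>R w + snd p))"
      by (intro continuous_on_compose2[OF cont(1)] continuous_intros) auto
    from borel_measurable_continuous_onI[OF this]
    have "(\<lambda>p. q (fst p *\<^sub>R w + snd p)) \<in> borel_measurable (borel \<Otimes>\<^sub>M borel)" by (simp only: borel_prod)
    then show ?thesis by (simp add: case_prod_beta')
  qed
  have fi: "integrable (lborel \<Otimes>\<^sub>M lborel) ?f"
  proof (rule lborel_pair.Fubini_integrable[OF fm])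
    have "(\<integral>x. norm (?f (t, x)) \<partial>lborel) = ?I t * (\<integral>x. norm (q x) \<partial>lborel)" for t
      using integral_lborel_shift[of "\<lambda>x. norm (q x)" "t *\<^sub>R w"] by (simp add: abs_mult)
    then show "integrable lborel (\<lambda>t. \<integral>x. norm (?f (t, x)) \<partial>lborel)" by simp
    show "AE t in lborel. integrable lborel (\<lambda>x. ?f (t, x))"
      using integrable_lborel_shift[OF int(1)] by (intro AE_I2) simp
  qed
  have "(\<integral>t. (\<integral>x. ?I t * q (t *\<^sub>R w + x) \<partial>lborel) \<partial>lborel) = (\<integral>x. (\<integral>t. ?I t * q (t *\<^sub>R w + x) \<partial>lborel) \<partial>lborel)"
    using lborel_pair.Fubini_integral[OF fi] by simp
  also have "\<dots> = (\<integral>x. \<Phi> (w + x) - \<Phi> x \<partial>lborel)" by (simp only: ftc)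
  also have "\<dots> = 0"
    using integrable_lborel_shift[OF int(2), of w] int(2)
      integral_lborel_shift[OF borel_measurable_continuous_onI[OF cont(2)], of w] by simp
  also have "(\<integral>t. (\<integral>x. ?I t * q (t *\<^sub>R w + x) \<partial>lborel) \<partial>lborel) = (\<integral>t. ?I t * (\<integral>x. q x \<partial>lborel) \<partial>lborel)"
    using integral_lborel_shift[OF qm] by simp
  also have "\<dots> = (\<integral>x. q x \<partial>lborel)" by simp
  also have "\<dots> = (\<integral>x. u x \<partial>gauss)"
    by (subst integral_gauss) (use tu in \<open>auto simp: q_def intro!: borel_measurable_continuous_onI tame_continuous\<close>)
  also have "\<dots> = (\<integral>x. w \<bullet> D x \<partial>gauss) - (\<integral>x. \<phi> x * (w \<bullet> x) \<partial>gauss)"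
    unfolding u_def
    by (subst Bochner_Integration.integral_diff)
       (auto intro!: tame_integrable[OF moment_measure_gauss] tame_intros simp: inner_commute)
  finally show ?thesis by simp
qed

section \<open>Weighted segments\<close>

text \<open>
The measure \<open>w t dt\<close> on \<open>{0..\<theta>}\<close>. Both line integrals (\<open>w = 1\<close>) and the random angle of the covariance
formula (\<open>w = sin\<close>, \<open>\<theta> = \<pi> / 2\<close>) are integrals against a measure with all moments, so the Fubini rules
for \<open>tame\<close> functions apply to them.
\<close>

definition seg :: "real \<Rightarrow> (real \<Rightarrow> real) \<Rightarrow> real measure" where
  "seg \<theta> w = density lborel (\<lambda>t. ennreal (indicator {0..\<theta>} t * w t))"

lemma integrable_seg_weight:
  fixes f w :: "real \<Rightarrow> real"
  assumes "continuous_on UNIV f" "continuous_on UNIV w"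
  shows "integrable lborel (\<lambda>t. (indicator {0..\<theta>} t * w t) * f t)"
proof -
  have "continuous_on {0..\<theta>} (\<lambda>t. w t * f t)"
    using assms by (intro continuous_intros) (auto intro: continuous_on_subset)
  from borel_integrable_compact[OF compact_Icc this]
  show ?thesis by (simp add: mult.assoc indicator_scaleR_eq_if if_distrib cong: if_cong)
qed

lemma integral_seg:
  fixes f w :: "real \<Rightarrow> real"
  assumes [measurable]: "f \<in> borel_measurable borel" and w: "continuous_on UNIV w" "\<And>t. t \<in> {0..\<theta>} \<Longrightarrow> 0 \<le> w t"
  shows "(\<integral>t. f t \<partial>(seg \<theta> w)) = (\<integral>t. indicator {0..\<theta>} t * (w t * f t) \<partial>lborel)"
proof -
  have [measurable]: "w \<in> borel_measurable borel" by (rule borel_measurable_continuous_onI[OF w(1)])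
  show ?thesis
    unfolding seg_def
    by (subst integral_density) (use w(2) in \<open>auto simp: mult.assoc split: split_indicator\<close>)
qed

lemma moment_measure_seg:
  assumes w: "continuous_on UNIV w" "\<And>t. t \<in> {0..\<theta>} \<Longrightarrow> 0 \<le> w t"
  shows "moment_measure (seg \<theta> w)"
proof -
  have [measurable]: "w \<in> borel_measurable borel" by (rule borel_measurable_continuous_onI[OF w(1)])
  have i: "integrable (seg \<theta> w) f" if "continuous_on UNIV f" for f :: "real \<Rightarrow> real"
    unfolding seg_def
    by (subst integrable_density)
       (use w(2) borel_measurable_continuous_onI[OF that] integrable_seg_weight[OF that w(1)]
         in \<open>auto split: split_indicator\<close>)
  have "finite_measure (seg \<theta> w)"
  proof (rule finite_measureI)
    have "integrable (seg \<theta> w) (\<lambda>_. 1::real)" by (rule i) simp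
    then show "emeasure (seg \<theta> w) (space (seg \<theta> w)) \<noteq> \<infinity>"
      by (simp add: integrable_iff_bounded)
  qed
  moreover have "integrable (seg \<theta> w) (\<lambda>x. norm x ^ k)" for k
    by (rule i) (intro continuous_intros)
  ultimately show ?thesis unfolding moment_measure_def by (simp add: seg_def)
qed

lemma integral_seg_FTC:
  assumes "0 \<le> \<theta>" and "\<And>t. (F has_real_derivative f t) (at t)" and "tame f"
  shows "(\<integral>t. f t \<partial>(seg \<theta> (\<lambda>_. 1))) = F \<theta> - F 0"
proof -
  have "continuous_on UNIV f" by (rule tame_continuous[OF assms(3)])
  then have "(\<integral>t. f t * indicator {0..\<theta>} t \<partial>lborel) = F \<theta> - F 0"
    using assms by (intro integral_FTC_Icc_real) (auto simp: continuous_on_eq_continuous_at)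
  then show ?thesis
    using borel_measurable_continuous_onI[OF \<open>continuous_on UNIV f\<close>]
    by (subst integral_seg) (auto simp: mult.commute)
qed

section \<open>The covariance formula\<close>

lemma tame_rot [tame_intros]:
  assumes "tame f" "tame g" shows "tame (\<lambda>x. rot (f x) (g x))"
  unfolding rot_def using assms by (intro tame_intros)

lemma rot_0 [simp]: "rot 0 p = p" by (simp add: rot_def)

lemma rot_add: "rot s (rot t p) = rot (s + t) p"
  by (simp add: rot_def cos_add sin_add algebra_simps)

lemma rot_pi_half: "rot (pi / 2) p = (snd p, - fst p)"
  by (simp add: rot_def)

lemma fst_rot_has_vector_derivative:
  "((\<lambda>t. fst (rot t p)) has_vector_derivative snd (rot t p)) (at t)"
  unfolding rot_def by (auto intro!: derivative_eq_intros simp: algebra_simps)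

text \<open>
The law of a random angle, whose cosine is uniform on \<open>[0, 1]\<close>, together with an independent standard
Gaussian vector.
\<close>

definition arc_measure :: "(real \<times> 'a::euclidean_space) measure" where
  "arc_measure = seg (pi / 2) sin \<Otimes>\<^sub>M gauss"

lemma moment_measure_seg_sin: "moment_measure (seg (pi / 2) sin)"
  by (rule moment_measure_seg) (auto intro!: continuous_intros sin_ge_zero)

lemma moment_measure_arc: "moment_measure arc_measure"
  unfolding arc_measure_def
  by (intro moment_measure_pair moment_measure_gauss moment_measure_seg_sin)

lemma integral_arc:
  fixes f :: "'a::euclidean_space \<times> (real \<times> 'a) \<Rightarrow> real"
  assumes f: "tame f"
  shows "(\<integral>x. (\<integral>q. f (x, q) \<partial>arc_measure) \<partial>gauss)
    = (\<integral>t. (\<integral>p. f (fst p, (t, snd p)) \<partial>gauss2) \<partial>(seg (pi / 2) sin))"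
proof -
  note c [tame_intros] = tame_compose[OF f]
  note mg = moment_measure_gauss and mS = moment_measure_seg_sin
  interpret S: finite_measure "seg (pi / 2) sin" by (rule moment_measureD[OF mS])
  interpret g: prob_space "gauss :: 'a measure" by (rule prob_space_gauss)
  interpret pair_sigma_finite "seg (pi / 2) sin" "gauss :: 'a measure" ..
  have 1: "(\<integral>x. (\<integral>q. f (x, q) \<partial>arc_measure) \<partial>gauss) = (\<integral>q. (\<integral>x. f (x, q) \<partial>gauss) \<partial>arc_measure)"
    using tame_Fubini(3,4)[OF mg moment_measure_arc f] by simp
  have "integrable arc_measure (\<lambda>q. \<integral>x. f (x, q) \<partial>gauss)"
    by (rule tame_Fubini(2)[OF mg moment_measure_arc f])
  then have "(\<integral>q. (\<integral>x. f (x, q) \<partial>gauss) \<partial>arc_measure) = (\<integral>t. (\<integral>z. (\<integral>x. f (x, (t, z)) \<partial>gauss) \<partial>gauss) \<partial>(seg (pi / 2) sin))"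
    using integral_fst[of "\<lambda>t z. \<integral>x. f (x, (t, z)) \<partial>gauss"]
    by (simp add: arc_measure_def case_prod_beta')
  also have "\<dots> = (\<integral>t. (\<integral>p. f (fst p, (t, snd p)) \<partial>gauss2) \<partial>(seg (pi / 2) sin))"
    using tame_Fubini(4)[OF mg mg, of "\<lambda>p. f (fst p, (t, snd p))" for t]
    by (simp add: tame_intros)
  finally show ?thesis using 1 by simp
qed

lemma cos_ne_minus_one: "0 \<le> t \<Longrightarrow> t \<le> pi / 2 \<Longrightarrow> cos t \<noteq> -1"
  using cos_ge_zero[of t] pi_gt_zero by linarith

text \<open>
Rotating back by \<open>t\<close> turns \<open>(fst (rot t p), snd (rot t p))\<close> into a pair of independent Gaussian vectors
\<open>(x, h)\<close> and \<open>fst p\<close> into \<open>cos t x - sin t h\<close>. Integration by parts in \<open>h\<close> alone produces the factor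
\<open>- sin t\<close>.
\<close>

lemma gauss_rot_integration_by_parts:
  fixes \<phi> :: "'a::euclidean_space \<Rightarrow> real" and D E :: "'a \<Rightarrow> 'a"
  assumes der: "\<And>x. (\<phi> has_derivative (\<lambda>h. D x \<bullet> h)) (at x)"
    and [tame_intros]: "tame \<phi>" "tame D" "tame E"
    and t: "0 \<le> t" "t \<le> pi / 2"
  shows "(\<integral>p. \<phi> (fst p) * (E (fst (rot t p)) \<bullet> snd (rot t p)) \<partial>gauss2)
    = - sin t * (\<integral>p. D (fst p) \<bullet> E (fst (rot t p)) \<partial>gauss2)"
proof -
  note c [tame_intros] = tame_compose[OF assms(2)] tame_compose[OF assms(3)] tame_compose[OF assms(4)]
  have inv: "rot (- t) (rot t p) = p" for p :: "'a \<times> 'a" by (simp add: rot_add)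
  have "(\<integral>p. \<phi> (fst p) * (E (fst (rot t p)) \<bullet> snd (rot t p)) \<partial>gauss2)
      = (\<integral>p. \<phi> (fst (rot (- t) p)) * (E (fst p) \<bullet> snd p) \<partial>gauss2)"
    using integral_rot[of "\<lambda>p. \<phi> (fst (rot (- t) p)) * (E (fst p) \<bullet> snd p)" t] cos_ne_minus_one[OF t]
    by (auto simp: inv tame_intros)
  also have "\<dots> = (\<integral>x. (\<integral>h. \<phi> (fst (rot (- t) (x, h))) * (E x \<bullet> h) \<partial>gauss) \<partial>gauss)"
    by (subst tame_Fubini(3)[OF moment_measure_gauss moment_measure_gauss, symmetric]) (auto intro!: tame_intros)
  also have "\<dots> = (\<integral>x. (\<integral>h. E x \<bullet> (- sin t *\<^sub>R D (fst (rot (- t) (x, h)))) \<partial>gauss) \<partial>gauss)"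
  proof (rule Bochner_Integration.integral_cong[OF refl])
    fix x :: 'a
    have "((\<lambda>h. \<phi> (fst (rot (- t) (x, h)))) has_derivative (\<lambda>h. (- sin t *\<^sub>R D (fst (rot (- t) (x, z)))) \<bullet> h)) (at z)" for z
    proof -
      have "((\<lambda>h. fst (rot (- t) (x, h))) has_derivative (\<lambda>h. - sin t *\<^sub>R h)) (at z)"
        unfolding rot_def by (auto intro!: derivative_eq_intros)
      from has_derivative_compose[OF this der] show ?thesis by simp
    qed
    then show "(\<integral>h. \<phi> (fst (rot (- t) (x, h))) * (E x \<bullet> h) \<partial>gauss)
        = (\<integral>h. E x \<bullet> (- sin t *\<^sub>R D (fst (rot (- t) (x, h)))) \<partial>gauss)"
      by (rule gauss_integration_by_parts) (intro tame_intros)+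
  qed
  also have "\<dots> = (\<integral>p. E (fst p) \<bullet> (- sin t *\<^sub>R D (fst (rot (- t) p))) \<partial>gauss2)"
    by (subst tame_Fubini(3)[OF moment_measure_gauss moment_measure_gauss, symmetric]) (auto intro!: tame_intros)
  also have "\<dots> = (\<integral>p. E (fst (rot t p)) \<bullet> (- sin t *\<^sub>R D (fst p)) \<partial>gauss2)"
    using integral_rot[of "\<lambda>p. E (fst p) \<bullet> (- sin t *\<^sub>R D (fst (rot (- t) p)))" t] cos_ne_minus_one[OF t]
    by (auto simp: inv tame_intros)
  also have "\<dots> = - sin t * (\<integral>p. D (fst p) \<bullet> E (fst (rot t p)) \<partial>gauss2)"
    by (simp add: inner_commute)
  finally show ?thesis .
qed

text \<open>
Write the covariance as the expectation of \<open>\<phi> x * (G x - G z)\<close> for an independent copy \<open>z\<close> of \<open>x\<close>,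
express \<open>G x - G z\<close> as an integral of the gradient of \<open>G\<close> along the arc from \<open>x\<close> to \<open>z\<close>, and integrate
by parts at each angle. In the language of the Ornstein-Uhlenbeck generator \<open>L\<close>, the inner integral is
\<open>- \<nabla> L\<^sup>-\<^sup>1 (G - E G)\<close>, written with Mehler's formula and \<open>cos t\<close> in place of \<open>exp (- t)\<close>.
\<close>

lemma gauss_covariance:
  fixes \<phi> G :: "'a::euclidean_space \<Rightarrow> real" and D E :: "'a \<Rightarrow> 'a"
  assumes der: "\<And>x. (\<phi> has_derivative (\<lambda>h. D x \<bullet> h)) (at x)" "\<And>x. (G has_derivative (\<lambda>h. E x \<bullet> h)) (at x)"
    and [tame_intros]: "tame \<phi>" "tame D" "tame G" "tame E"
  shows "(\<integral>x. \<phi> x * (G x - (\<integral>y. G y \<partial>gauss)) \<partial>gauss)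
    = (\<integral>x. D x \<bullet> (\<integral>q. E (cos (fst q) *\<^sub>R x + sin (fst q) *\<^sub>R snd q) \<partial>arc_measure) \<partial>gauss)"
proof -
  note c [tame_intros] = tame_compose[OF assms(3)] tame_compose[OF assms(4)] tame_compose[OF assms(5)] tame_compose[OF assms(6)]
  note mg = moment_measure_gauss
  interpret g: prob_space "gauss :: 'a measure" by (rule prob_space_gauss)
  let ?S = "seg (pi / 2) (\<lambda>_. 1)"
  let ?k = "\<lambda>p t. D (fst p) \<bullet> E (fst (rot t p))"
  have mS: "moment_measure ?S" by (rule moment_measure_seg) auto
  have "(\<integral>x. \<phi> x * (G x - (\<integral>y. G y \<partial>gauss)) \<partial>gauss) = (\<integral>x. (\<integral>y. \<phi> x * (G x - G y) \<partial>gauss) \<partial>gauss)"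
  proof (rule Bochner_Integration.integral_cong[OF refl])
    fix x
    have "integrable gauss G" by (intro tame_integrable[OF mg] tame_intros)
    then show "\<phi> x * (G x - (\<integral>y. G y \<partial>gauss)) = (\<integral>y. \<phi> x * (G x - G y) \<partial>gauss)"
      using g.prob_space by simp
  qed
  also have "\<dots> = (\<integral>p. \<phi> (fst p) * (G (fst p) - G (snd p)) \<partial>gauss2)"
    by (subst tame_Fubini(3)[OF mg mg, symmetric]) (auto intro!: tame_intros)
  also have "\<dots> = (\<integral>p. (\<integral>t. - (\<phi> (fst p) * (E (fst (rot t p)) \<bullet> snd (rot t p))) \<partial>?S) \<partial>gauss2)"
  proof (rule Bochner_Integration.integral_cong[OF refl])
    fix p :: "'a \<times> 'a"
    have "(\<integral>t. E (fst (rot t p)) \<bullet> snd (rot t p) \<partial>?S) = G (fst (rot (pi / 2) p)) - G (fst (rot 0 p))"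
      by (rule integral_seg_FTC)
         (auto intro!: tame_intros has_real_derivative_along[OF der(2)] fst_rot_has_vector_derivative)
    then have h: "(\<integral>t. E (fst (rot t p)) \<bullet> snd (rot t p) \<partial>?S) = G (snd p) - G (fst p)"
      by (simp add: rot_pi_half)
    show "\<phi> (fst p) * (G (fst p) - G (snd p)) = (\<integral>t. - (\<phi> (fst p) * (E (fst (rot t p)) \<bullet> snd (rot t p))) \<partial>?S)"
      by (simp only: Bochner_Integration.integral_minus integral_mult_right_zero h) (simp add: algebra_simps)
  qed
  also have "\<dots> = (\<integral>t. (\<integral>p. - (\<phi> (fst p) * (E (fst (rot t p)) \<bullet> snd (rot t p))) \<partial>gauss2) \<partial>?S)"
    using tame_Fubini(3,4)[OF moment_measure_gauss2 mS, of "\<lambda>z. - (\<phi> (fst (fst z)) * (E (fst (rot (snd z) (fst z))) \<bullet> snd (rot (snd z) (fst z))))"]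
    by (simp add: tame_intros)
  also have "\<dots> = (\<integral>t. indicator {0..pi/2} t * (1 * (\<integral>p. - (\<phi> (fst p) * (E (fst (rot t p)) \<bullet> snd (rot t p))) \<partial>gauss2)) \<partial>lborel)"
  proof (rule integral_seg)
    have "integrable ?S (\<lambda>t. \<integral>p. - (\<phi> (fst p) * (E (fst (rot t p)) \<bullet> snd (rot t p))) \<partial>gauss2)"
      using tame_Fubini(2)[OF moment_measure_gauss2 mS, of "\<lambda>z. - (\<phi> (fst (fst z)) * (E (fst (rot (snd z) (fst z))) \<bullet> snd (rot (snd z) (fst z))))"]
      by (simp add: tame_intros)
    then show "(\<lambda>t. \<integral>p. - (\<phi> (fst p) * (E (fst (rot t p)) \<bullet> snd (rot t p))) \<partial>gauss2) \<in> borel_measurable borel"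
      by (simp add: seg_def integrable_iff_bounded)
  qed auto
  also have "\<dots> = (\<integral>t. indicator {0..pi/2} t * (sin t * (\<integral>p. ?k p t \<partial>gauss2)) \<partial>lborel)"
  proof (rule Bochner_Integration.integral_cong[OF refl])
    fix t :: real
    show "indicator {0..pi/2} t * (1 * (\<integral>p. - (\<phi> (fst p) * (E (fst (rot t p)) \<bullet> snd (rot t p))) \<partial>gauss2))
      = indicator {0..pi/2} t * (sin t * (\<integral>p. ?k p t \<partial>gauss2))"
      using gauss_rot_integration_by_parts[OF der(1) assms(3,4,6), of t] by (cases "t \<in> {0..pi/2}") auto
  qed
  also have "\<dots> = (\<integral>t. (\<integral>p. ?k p t \<partial>gauss2) \<partial>(seg (pi / 2) sin))"
  proof (rule integral_seg[symmetric])
    have "integrable ?S (\<lambda>t. \<integral>p. ?k p t \<partial>gauss2)"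
      using tame_Fubini(2)[OF moment_measure_gauss2 mS, of "\<lambda>z. ?k (fst z) (snd z)"]
      by (simp add: tame_intros)
    then show "(\<lambda>t. \<integral>p. ?k p t \<partial>gauss2) \<in> borel_measurable borel"
      by (simp add: seg_def integrable_iff_bounded)
  qed (auto intro!: continuous_intros sin_ge_zero)
  also have "\<dots> = (\<integral>x. (\<integral>q. D x \<bullet> E (cos (fst q) *\<^sub>R x + sin (fst q) *\<^sub>R snd q) \<partial>arc_measure) \<partial>gauss)"
    using integral_arc[of "\<lambda>z. D (fst z) \<bullet> E (cos (fst (snd z)) *\<^sub>R fst z + sin (fst (snd z)) *\<^sub>R snd (snd z))"]
    by (simp add: tame_intros rot_def)
  also have "\<dots> = (\<integral>x. D x \<bullet> (\<integral>q. E (cos (fst q) *\<^sub>R x + sin (fst q) *\<^sub>R snd q) \<partial>arc_measure) \<partial>gauss)"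
    by (intro Bochner_Integration.integral_cong[OF refl] integral_inner_right
        tame_integrable[OF moment_measure_arc] tame_intros)
  finally show ?thesis .
qed

section \<open>Second moments\<close>

text \<open>
The Cauchy-Schwarz inequality for \<open>f\<close> and the constant 1, from the nonnegativity of the integral of
\<open>(m f - I)\<^sup>2\<close>, where \<open>I\<close> is the integral of \<open>f\<close>.
\<close>

lemma square_integral_le:
  fixes f :: "'a::euclidean_space \<Rightarrow> real"
  assumes M: "moment_measure M" and f: "tame f" and m: "measure M (space M) \<le> m" "0 < m"
  shows "(\<integral>x. f x \<partial>M)\<^sup>2 \<le> m * (\<integral>x. (f x)\<^sup>2 \<partial>M)"
proof -
  interpret finite_measure M by (rule moment_measureD[OF M])
  let ?I = "\<integral>x. f x \<partial>M"
  have i: "integrable M f" "integrable M (\<lambda>x. (f x)\<^sup>2)"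
    using f by (auto intro!: tame_integrable[OF M] tame_intros)
  have "0 \<le> (\<integral>x. (m * f x - ?I)\<^sup>2 \<partial>M)" by simp
  also have "\<dots> = (\<integral>x. m\<^sup>2 * (f x)\<^sup>2 - (2 * m * ?I) * f x + ?I\<^sup>2 \<partial>M)"
    by (intro Bochner_Integration.integral_cong refl) (simp add: power2_eq_square algebra_simps)
  also have "\<dots> = m\<^sup>2 * (\<integral>x. (f x)\<^sup>2 \<partial>M) - (2 * m * ?I) * ?I + ?I\<^sup>2 * measure M (space M)"
    using i by (simp add: Bochner_Integration.integral_add Bochner_Integration.integral_diff)
  also have "\<dots> \<le> m\<^sup>2 * (\<integral>x. (f x)\<^sup>2 \<partial>M) - (2 * m * ?I) * ?I + ?I\<^sup>2 * m"
    using m by (simp add: mult_left_mono)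
  also have "\<dots> = m * (m * (\<integral>x. (f x)\<^sup>2 \<partial>M) - ?I\<^sup>2)"
    by (simp add: power2_eq_square algebra_simps)
  finally show ?thesis using m(2) by (simp add: zero_le_mult_iff)
qed

lemma gauss_second_moment:
  fixes w :: "'a::euclidean_space"
  shows "(\<integral>z. (w \<bullet> z)\<^sup>2 \<partial>gauss) = (norm w)\<^sup>2"
proof -
  interpret prob_space "gauss :: 'a measure" by (rule prob_space_gauss)
  have "(\<integral>z. (w \<bullet> z) * (w \<bullet> z) \<partial>gauss) = (\<integral>z. w \<bullet> w \<partial>(gauss :: 'a measure))"
    by (rule gauss_integration_by_parts[where \<phi> = "\<lambda>z. w \<bullet> z" and D = "\<lambda>z. w"])
       (auto intro!: tame_intros derivative_eq_intros)
  then show ?thesis unfolding power2_norm_eq_inner using prob_space by (simp add: power2_eq_square)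
qed

lemma integral_tame_mono:
  fixes f g :: "'a::euclidean_space \<Rightarrow> real"
  assumes "moment_measure M" "tame f" "tame g" "\<And>x. f x \<le> g x"
  shows "(\<integral>x. f x \<partial>M) \<le> (\<integral>x. g x \<partial>M)"
  using assms by (intro integral_mono tame_integrable) auto

lemma gauss2_fst:
  fixes f :: "'a::euclidean_space \<Rightarrow> real"
  assumes "tame f" shows "(\<integral>p. f (fst p) \<partial>gauss2) = (\<integral>x. f x \<partial>gauss)"
proof -
  interpret prob_space "gauss :: 'a measure" by (rule prob_space_gauss)
  have "tame (\<lambda>p :: 'a \<times> 'a. f (fst p))" by (intro tame_compose[OF assms] tame_intros)
  then show ?thesis
    using tame_Fubini(3)[OF moment_measure_gauss moment_measure_gauss, of "\<lambda>p :: 'a \<times> 'a. f (fst p)"] prob_space by simp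
qed

lemma measure_seg_one: "0 \<le> \<theta> \<Longrightarrow> measure (seg \<theta> (\<lambda>_. 1)) (space (seg \<theta> (\<lambda>_. 1))) = \<theta>"
  using integral_seg_FTC[of \<theta> "\<lambda>t. t" "\<lambda>_. 1"] by (auto simp: tame_intros)

lemma integral_seg_sin_FTC:
  assumes "\<And>t. (F has_real_derivative sin t * f t) (at t)" and "tame f"
  shows "(\<integral>t. f t \<partial>(seg (pi / 2) sin)) = F (pi / 2) - F 0"
proof -
  have m: "f \<in> borel_measurable borel" by (rule borel_measurable_continuous_onI[OF tame_continuous[OF assms(2)]])
  have "(\<integral>t. f t \<partial>(seg (pi / 2) sin)) = (\<integral>t. sin t * f t \<partial>(seg (pi / 2) (\<lambda>_. 1)))"
    using m by (subst (1 2) integral_seg) (auto intro!: continuous_intros sin_ge_zero)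
  also have "\<dots> = F (pi / 2) - F 0"
    using assms by (intro integral_seg_FTC) (auto intro!: tame_intros)
  finally show ?thesis .
qed

lemma prob_space_seg_sin: "prob_space (seg (pi / 2) sin)"
proof -
  interpret finite_measure "seg (pi / 2) sin" by (rule moment_measureD[OF moment_measure_seg_sin])
  have "(\<integral>t. 1 \<partial>(seg (pi / 2) sin)) = - cos (pi / 2) - (- cos 0)"
    by (rule integral_seg_sin_FTC) (auto intro!: tame_intros derivative_eq_intros)
  then show ?thesis by (intro prob_spaceI) (simp add: emeasure_eq_measure)
qed

text \<open>
An average over the random angle contracts increments: this factor 1/3 bounds the contribution
of \<open>V\<close> to the variance of \<open>T\<close>, and with 1 in its place the final constant would exceed 16.
\<close>

lemma integral_seg_sin_cos_square: "(\<integral>t. (cos t)\<^sup>2 \<partial>(seg (pi / 2) sin)) = 1 / 3"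
proof -
  have "(\<integral>t. (cos t)\<^sup>2 \<partial>(seg (pi / 2) sin)) = - ((cos (pi / 2))^3 / 3) - (- ((cos 0)^3 / 3))"
    by (rule integral_seg_sin_FTC) (auto intro!: tame_intros derivative_eq_intros)
  then show ?thesis by simp
qed

lemma prob_space_arc: "prob_space arc_measure"
  unfolding arc_measure_def by (intro prob_space_pair prob_space_gauss prob_space_seg_sin)

lemma one_minus_cos_le: "0 \<le> t \<Longrightarrow> 1 - cos t \<le> (t::real)"
proof -
  assume t: "0 \<le> t"
  have "1 - cos t = 2 * (sin (t / 2) * sin (t / 2))"
    using cos_double_sin[of "t / 2"] by (simp add: power2_eq_square)
  also have "\<dots> \<le> 2 * (\<bar>sin (t / 2)\<bar> * 1)"
  proof -
    have "\<bar>sin (t / 2)\<bar> * \<bar>sin (t / 2)\<bar> \<le> \<bar>sin (t / 2)\<bar> * 1" by (intro mult_left_mono) auto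
    then show ?thesis by simp
  qed
  also have "\<dots> \<le> t" using abs_sin_x_le_abs_x[of "t / 2"] t by simp
  finally show ?thesis .
qed

lemma norm_fst_rot_diff_le:
  assumes "0 \<le> t" shows "norm (fst (rot t p) - fst p) \<le> t * (norm (fst p) + norm (snd p))"
proof -
  have "fst (rot t p) - fst p = (- (1 - cos t)) *\<^sub>R fst p + sin t *\<^sub>R snd p"
    by (simp add: rot_def algebra_simps)
  also have "norm \<dots> \<le> (1 - cos t) * norm (fst p) + \<bar>sin t\<bar> * norm (snd p)"
    using norm_triangle_ineq[of "(- (1 - cos t)) *\<^sub>R fst p" "sin t *\<^sub>R snd p"] by simp
  also have "\<dots> \<le> t * norm (fst p) + t * norm (snd p)"
    using one_minus_cos_le[OF assms] abs_sin_x_le_abs_x[of t] assms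
    by (intro add_mono mult_right_mono) auto
  finally show ?thesis by (simp add: algebra_simps)
qed

lemma norm_snd_rot_le: "norm (snd (rot t p)) \<le> norm (fst p) + norm (snd p)"
proof -
  have "norm (snd (rot t p)) \<le> \<bar>cos t\<bar> * norm (snd p) + \<bar>sin t\<bar> * norm (fst p)"
    using norm_triangle_ineq4[of "cos t *\<^sub>R snd p" "sin t *\<^sub>R fst p"] by (simp add: rot_def)
  also have "\<dots> \<le> 1 * norm (snd p) + 1 * norm (fst p)"
    by (intro add_mono mult_right_mono) auto
  finally show ?thesis by simp
qed

section \<open>Increments of a gradient field along a short arc\<close>

text \<open>
The coefficient of \<open>\<epsilon>\<^sup>2\<close> in the pointwise error of the exchange of directions in \<open>gradient_increment\<close>.
It depends on \<open>v\<close> but not on the gradient field, so that the estimate is uniform over the fields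
\<open>x \<mapsto> R (cos t x + sin t z)\<close>.
\<close>

definition arc_error :: "('a::euclidean_space \<Rightarrow> 'a) \<Rightarrow> 'a \<times> 'a \<Rightarrow> real" where
  "arc_error v p = (norm (fst p) + norm (snd p))\<^sup>2 + 4 * (norm (v (fst p)))\<^sup>2"

lemma tame_arc_error:
  assumes "tame v" shows "tame (arc_error v)"
  unfolding arc_error_def by (intro tame_intros tame_compose[OF assms])

text \<open>
The weight of the error term may be large, since errors are of higher order in \<open>\<epsilon>\<close>; the factor
11/10 of the main term is affordable in the final constant.
\<close>

lemma square_add_le:
  fixes a b :: real
  shows "(a + b)\<^sup>2 \<le> 11 / 10 * a\<^sup>2 + 11 * b\<^sup>2"
proof -
  have "0 \<le> (a - 10 * b)\<^sup>2" by simp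
  then show ?thesis by (simp add: power2_eq_square algebra_simps)
qed

text \<open>
The second difference of \<open>\<Psi>\<close> at the ends of the arc, with step \<open>\<delta> v (fst p)\<close>, is evaluated in two ways.
By the quadratic approximation it is \<open>\<delta>\<close> times the increment of \<open>U\<close> along the arc, paired with
\<open>v (fst p)\<close>. By the fundamental theorem of calculus it is the integral over the arc of an increment
of \<open>U\<close> with step \<open>\<delta> v (fst p)\<close>, paired with the velocity. Replacing \<open>v (fst p)\<close> by the value of \<open>v\<close> at the
current point costs little since \<open>v\<close> is Lipschitz, and then the velocity is a standard
Gaussian vector independent of the vector \<open>w\<close> it is paired with: the second moment of the pairing is that
of \<open>w\<close>, with no dimensional factor.
\<close>

lemma gradient_increment:
  fixes \<Psi> :: "'a::euclidean_space \<Rightarrow> real" and U v :: "'a \<Rightarrow> 'a"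
  assumes der: "\<And>x. (\<Psi> has_derivative (\<lambda>h. U x \<bullet> h)) (at x)"
    and quad: "\<And>x y. \<bar>\<Psi> y - \<Psi> x - U x \<bullet> (y - x)\<bar> \<le> 2 * (norm (y - x))\<^sup>2"
    and U: "\<And>x y. norm (U x - U y) \<le> c * norm (x - y)" and c: "0 \<le> c" "c \<le> 1"
    and v: "\<And>x y. norm (v x - v y) \<le> norm (x - y)"
    and \<epsilon>: "0 < \<epsilon>" "\<epsilon> \<le> pi / 2"
  shows "(\<integral>p. ((U (fst (rot \<epsilon> p)) - U (fst p)) \<bullet> v (fst p))\<^sup>2 \<partial>gauss2)
     \<le> 11 / 10 * c\<^sup>2 * \<epsilon>\<^sup>2 * (\<integral>x. (norm (v x))\<^sup>2 \<partial>gauss) + 11 * \<epsilon> ^ 4 * (\<integral>p. (arc_error v p)\<^sup>2 \<partial>gauss2)"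
proof -
  \<comment> \<open>The quadratic approximation costs an error of order \<open>\<delta>\<close> after division by \<open>\<delta>\<close>; the choice
      \<open>\<delta> = \<epsilon>\<^sup>2\<close> makes it of the same order as the other errors.\<close>
  define \<delta> where "\<delta> = \<epsilon>\<^sup>2"
  have \<delta>: "0 < \<delta>" using \<epsilon> by (simp add: \<delta>_def)
  have tU: "tame U" by (rule tame_lipschitz[OF U])
  have tv: "tame v" by (rule tame_lipschitz[of v 1]) (use v in simp)
  note tc [tame_intros] = tame_compose[OF tU] tame_compose[OF tv] tame_compose[OF tame_arc_error[OF tv]]
  let ?S = "seg \<epsilon> (\<lambda>_. 1)"
  have mS: "moment_measure ?S" by (rule moment_measure_seg) auto
  interpret S: finite_measure ?S by (rule moment_measureD[OF mS])
  note m2 = moment_measure_gauss2 and mg = moment_measure_gauss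
  define w where "w = (\<lambda>x. U (x + \<delta> *\<^sub>R v x) - U x)"
  have tw [tame_intros]: "tame f \<Longrightarrow> tame (\<lambda>x. w (f x))" for f :: "'b::real_normed_vector \<Rightarrow> 'a"
    unfolding w_def by (intro tame_intros)
  define m where "m = (\<lambda>p t. w (fst (rot t p)) \<bullet> snd (rot t p))"
  have tm [tame_intros]: "tame f \<Longrightarrow> tame g \<Longrightarrow> tame (\<lambda>x. m (f x) (g x))" for f :: "'b::real_normed_vector \<Rightarrow> _" and g
    unfolding m_def by (intro tame_intros)
  have tmp: "tame (m p)" for p
    using tm[OF tame_const tame_ident, of p] by simp
  define M where "M = (\<lambda>p. (\<integral>t. m p t \<partial>?S) / \<delta>)"
  define D where "D = (\<lambda>p. (U (fst (rot \<epsilon> p)) - U (fst p)) \<bullet> v (fst p))"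
  have wle: "(norm (w x))\<^sup>2 \<le> c\<^sup>2 * \<delta>\<^sup>2 * (norm (v x))\<^sup>2" for x
  proof -
    have "norm (w x) \<le> c * (\<delta> * norm (v x))"
      using U[of "x + \<delta> *\<^sub>R v x" x] \<delta> by (simp add: w_def)
    then have "(norm (w x))\<^sup>2 \<le> (c * (\<delta> * norm (v x)))\<^sup>2" by (intro power_mono) auto
    then show ?thesis by (simp add: power_mult_distrib mult.assoc)
  qed
  \<comment> \<open>\<open>D\<close> is the increment to be estimated and \<open>M\<close> its replacement with exchanged directions.\<close>
  have pw: "\<bar>D p - M p\<bar> \<le> \<epsilon>\<^sup>2 * arc_error v p" for p
  proof -
    let ?x = "fst p" and ?y = "fst (rot \<epsilon> p)" and ?r = "norm (fst p) + norm (snd p)"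
    let ?v = "v (fst p)"
    define s where "s = (\<lambda>t. (U (fst (rot t p) + \<delta> *\<^sub>R ?v) - U (fst (rot t p))) \<bullet> snd (rot t p))"
    have ts: "tame s" unfolding s_def by (intro tame_intros)
    have "((\<lambda>t. \<Psi> (fst (rot t p) + \<delta> *\<^sub>R ?v) - \<Psi> (fst (rot t p))) has_real_derivative s t) (at t)" for t
    proof -
      have "((\<lambda>t. fst (rot t p) + \<delta> *\<^sub>R ?v) has_vector_derivative snd (rot t p)) (at t)"
        using has_vector_derivative_add[OF fst_rot_has_vector_derivative has_vector_derivative_const] by simp
      from DERIV_diff[OF has_real_derivative_along[OF der this] has_real_derivative_along[OF der fst_rot_has_vector_derivative]]
      show ?thesis by (simp add: s_def inner_diff_left)
    qed
    from integral_seg_FTC[OF _ this ts, of \<epsilon>]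
    have S: "(\<integral>t. s t \<partial>?S) = (\<Psi> (?y + \<delta> *\<^sub>R ?v) - \<Psi> ?y) - (\<Psi> (?x + \<delta> *\<^sub>R ?v) - \<Psi> ?x)"
      using \<epsilon> by simp
    have q: "\<bar>\<Psi> (z + \<delta> *\<^sub>R ?v) - \<Psi> z - \<delta> * (U z \<bullet> ?v)\<bar> \<le> 2 * \<delta>\<^sup>2 * (norm ?v)\<^sup>2" for z
      using quad[of "z + \<delta> *\<^sub>R ?v" z] by (simp add: power_mult_distrib)
    have 1: "\<bar>\<delta> * D p - (\<integral>t. s t \<partial>?S)\<bar> \<le> 4 * \<delta>\<^sup>2 * (norm ?v)\<^sup>2"
    proof -
      have "\<delta> * D p = \<delta> * (U ?y \<bullet> ?v) - \<delta> * (U ?x \<bullet> ?v)" by (simp add: D_def inner_diff_left algebra_simps)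
      then show ?thesis using S q[of ?x] q[of ?y] by linarith
    qed
    have 2: "\<bar>(\<integral>t. s t \<partial>?S) - (\<integral>t. m p t \<partial>?S)\<bar> \<le> \<epsilon> * (\<delta> * \<epsilon> * ?r\<^sup>2)"
    proof -
      have i: "integrable ?S s" "integrable ?S (m p)"
        by (rule tame_integrable[OF mS ts], rule tame_integrable[OF mS tmp])
      have ae: "AE t in ?S. norm (s t - m p t) \<le> \<delta> * \<epsilon> * ?r\<^sup>2"
      proof -
        have "norm (s t - m p t) \<le> \<delta> * \<epsilon> * ?r\<^sup>2" if t: "0 \<le> t" "t \<le> \<epsilon>" for t
        proof -
          let ?z = "fst (rot t p)"
          have "s t - m p t = (U (?z + \<delta> *\<^sub>R ?v) - U (?z + \<delta> *\<^sub>R v ?z)) \<bullet> snd (rot t p)"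
            by (simp add: s_def m_def w_def inner_diff_left)
          also have "norm \<dots> \<le> norm (U (?z + \<delta> *\<^sub>R ?v) - U (?z + \<delta> *\<^sub>R v ?z)) * norm (snd (rot t p))"
            by (simp add: Cauchy_Schwarz_ineq2)
          also have "\<dots> \<le> (\<delta> * (\<epsilon> * ?r)) * ?r"
          proof (rule mult_mono[OF _ norm_snd_rot_le])
            have "norm (U (?z + \<delta> *\<^sub>R ?v) - U (?z + \<delta> *\<^sub>R v ?z)) \<le> c * norm (\<delta> *\<^sub>R (?v - v ?z))"
              using U[of "?z + \<delta> *\<^sub>R ?v" "?z + \<delta> *\<^sub>R v ?z"] by (simp add: scaleR_diff_right)
            also have "\<dots> \<le> 1 * norm (\<delta> *\<^sub>R (?v - v ?z))" using c by (intro mult_right_mono) auto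
            also have "\<dots> = \<delta> * norm (v ?z - ?v)" using \<delta> by (simp add: norm_minus_commute)
            also have "\<dots> \<le> \<delta> * (\<epsilon> * ?r)"
            proof (rule mult_left_mono)
              have "norm (v ?z - ?v) \<le> t * ?r"
                using v[of ?z ?x] norm_fst_rot_diff_le[OF t(1), of p] by linarith
              also have "\<dots> \<le> \<epsilon> * ?r" using t by (intro mult_right_mono) auto
              finally show "norm (v ?z - ?v) \<le> \<epsilon> * ?r" .
            qed (use \<delta> in simp)
            finally show "norm (U (?z + \<delta> *\<^sub>R ?v) - U (?z + \<delta> *\<^sub>R v ?z)) \<le> \<delta> * (\<epsilon> * ?r)" .
          qed (use \<delta> \<epsilon> in auto)
          finally show ?thesis by (simp add: power2_eq_square mult_ac)
        qed
        then show ?thesis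
          unfolding seg_def by (subst AE_density) (auto split: split_indicator)
      qed
      have "norm ((\<integral>t. s t \<partial>?S) - (\<integral>t. m p t \<partial>?S)) = norm (\<integral>t. s t - m p t \<partial>?S)"
        using i by simp
      also have "\<dots> \<le> (\<integral>t. norm (s t - m p t) \<partial>?S)" by (rule integral_norm_bound)
      also have "\<dots> \<le> (\<integral>t. \<delta> * \<epsilon> * ?r\<^sup>2 \<partial>?S)"
        using i ae by (intro integral_mono_AE) auto
      also have "\<dots> = \<epsilon> * (\<delta> * \<epsilon> * ?r\<^sup>2)"
        using measure_seg_one[of \<epsilon>] \<epsilon> by simp
      finally show ?thesis by simp
    qed
    have "\<bar>\<delta> * D p - \<delta> * M p\<bar> \<le> 4 * \<delta>\<^sup>2 * (norm ?v)\<^sup>2 + \<epsilon> * (\<delta> * \<epsilon> * ?r\<^sup>2)"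
      using 1 2 \<delta> by (simp add: M_def)
    also have "\<dots> = \<delta> * (\<epsilon>\<^sup>2 * arc_error v p)"
      unfolding \<delta>_def arc_error_def by (simp add: power2_eq_square algebra_simps)
    finally have "\<delta> * \<bar>D p - M p\<bar> \<le> \<delta> * (\<epsilon>\<^sup>2 * arc_error v p)"
      using \<delta> by (simp add: abs_mult right_diff_distrib[symmetric])
    then show ?thesis using \<delta> by simp
  qed
  have tD: "tame D" unfolding D_def by (intro tame_intros)
  have Msq: "(M p)\<^sup>2 \<le> \<epsilon> / \<delta>\<^sup>2 * (\<integral>t. (m p t)\<^sup>2 \<partial>?S)" for p
    using square_integral_le[OF mS, of "m p" \<epsilon>] measure_seg_one[of \<epsilon>] \<epsilon> \<delta>
    by (simp add: M_def power_divide tmp divide_right_mono)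
  have Dsq: "(D p)\<^sup>2 \<le> 11 / 10 * (\<epsilon> / \<delta>\<^sup>2 * (\<integral>t. (m p t)\<^sup>2 \<partial>?S)) + 11 * \<epsilon> ^ 4 * (arc_error v p)\<^sup>2" for p
  proof -
    have "(D p)\<^sup>2 \<le> 11 / 10 * (M p)\<^sup>2 + 11 * (D p - M p)\<^sup>2" using square_add_le[of "M p" "D p - M p"] by simp
    moreover have "\<bar>D p - M p\<bar>\<^sup>2 \<le> (\<epsilon>\<^sup>2 * arc_error v p)\<^sup>2" using pw by (intro power_mono) auto
    then have "(D p - M p)\<^sup>2 \<le> \<epsilon> ^ 4 * (arc_error v p)\<^sup>2" by (simp add: power_mult_distrib)
    ultimately show ?thesis using Msq[of p] by linarith
  qed
  have tm2: "tame (\<lambda>z. (m (fst z) (snd z))\<^sup>2)" by (intro tame_intros)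
  have im: "integrable gauss2 (\<lambda>p. \<integral>t. (m p t)\<^sup>2 \<partial>?S)"
    using tame_Fubini(1)[OF m2 mS tm2] by simp
  \<comment> \<open>Rotation makes point and velocity at time \<open>t\<close> an independent pair of Gaussian vectors.\<close>
  have inner: "(\<integral>p. (m p t)\<^sup>2 \<partial>gauss2) = (\<integral>x. (norm (w x))\<^sup>2 \<partial>gauss)" if "0 \<le> t" "t \<le> \<epsilon>" for t
  proof -
    have "(\<integral>p. (m p t)\<^sup>2 \<partial>gauss2) = (\<integral>p. (w (fst p) \<bullet> snd p)\<^sup>2 \<partial>gauss2)"
      unfolding m_def using integral_rot[of "\<lambda>p. (w (fst p) \<bullet> snd p)\<^sup>2" t] cos_ne_minus_one[of t] that \<epsilon>
      by (simp add: tame_intros)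
    also have "\<dots> = (\<integral>x. (\<integral>h. (w x \<bullet> h)\<^sup>2 \<partial>gauss) \<partial>gauss)"
      by (subst tame_Fubini(3)[OF mg mg, symmetric]) (auto intro!: tame_intros)
    finally show ?thesis by (simp add: gauss_second_moment)
  qed
  have Em: "(\<integral>p. (\<integral>t. (m p t)\<^sup>2 \<partial>?S) \<partial>gauss2) \<le> \<epsilon> * (c\<^sup>2 * \<delta>\<^sup>2 * (\<integral>x. (norm (v x))\<^sup>2 \<partial>gauss))"
  proof -
    have "(\<integral>p. (\<integral>t. (m p t)\<^sup>2 \<partial>?S) \<partial>gauss2) = (\<integral>t. (\<integral>p. (m p t)\<^sup>2 \<partial>gauss2) \<partial>?S)"
      using tame_Fubini(3,4)[OF m2 mS tm2] by simp
    also have "\<dots> = (\<integral>t. (\<integral>x. (norm (w x))\<^sup>2 \<partial>gauss) \<partial>?S)"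
    proof (rule integral_cong_AE)
      have "integrable ?S (\<lambda>t. \<integral>p. (m p t)\<^sup>2 \<partial>gauss2)" using tame_Fubini(2)[OF m2 mS tm2] by simp
      then show "(\<lambda>t. \<integral>p. (m p t)\<^sup>2 \<partial>gauss2) \<in> borel_measurable ?S" by simp
      show "AE t in ?S. (\<integral>p. (m p t)\<^sup>2 \<partial>gauss2) = (\<integral>x. (norm (w x))\<^sup>2 \<partial>gauss)"
        unfolding seg_def using inner by (subst AE_density) (auto split: split_indicator)
    qed simp
    also have "\<dots> = \<epsilon> * (\<integral>x. (norm (w x))\<^sup>2 \<partial>gauss)"
      using measure_seg_one[of \<epsilon>] \<epsilon> by simp
    also have "\<dots> \<le> \<epsilon> * (\<integral>x. c\<^sup>2 * \<delta>\<^sup>2 * (norm (v x))\<^sup>2 \<partial>gauss)"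
      using \<epsilon> by (intro mult_left_mono integral_tame_mono[OF mg] tame_intros wle) auto
    finally show ?thesis by simp
  qed
  define A where "A = (\<integral>x. (norm (v x))\<^sup>2 \<partial>gauss)"
  define B where "B = (\<integral>p. (arc_error v p)\<^sup>2 \<partial>gauss2)"
  define J where "J = (\<integral>p. (\<integral>t. (m p t)\<^sup>2 \<partial>?S) \<partial>gauss2)"
  have iB: "integrable gauss2 (\<lambda>p. (arc_error v p)\<^sup>2)" by (intro tame_integrable[OF m2] tame_intros)
  have iD: "integrable gauss2 (\<lambda>p. (D p)\<^sup>2)" by (intro tame_integrable[OF m2] tame_power tD)
  have "(\<integral>p. (D p)\<^sup>2 \<partial>gauss2)
      \<le> (\<integral>p. 11 / 10 * (\<epsilon> / \<delta>\<^sup>2 * (\<integral>t. (m p t)\<^sup>2 \<partial>?S)) + 11 * \<epsilon> ^ 4 * (arc_error v p)\<^sup>2 \<partial>gauss2)"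
    by (intro integral_mono iD Bochner_Integration.integrable_add integrable_mult_right iB im Dsq)
  also have "\<dots> = 11 / 10 * (\<epsilon> / \<delta>\<^sup>2 * J) + 11 * \<epsilon> ^ 4 * B"
    unfolding J_def B_def
    by (subst Bochner_Integration.integral_add) (intro integrable_mult_right iB im | simp only: integral_mult_right_zero)+
  also have "\<dots> \<le> 11 / 10 * (\<epsilon> / \<delta>\<^sup>2 * (\<epsilon> * (c\<^sup>2 * \<delta>\<^sup>2 * A))) + 11 * \<epsilon> ^ 4 * B"
    using Em[folded J_def A_def] \<epsilon> by (intro add_right_mono mult_left_mono) auto
  also have "\<epsilon> / \<delta>\<^sup>2 * (\<epsilon> * (c\<^sup>2 * \<delta>\<^sup>2 * A)) = c\<^sup>2 * \<epsilon>\<^sup>2 * A"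
    using \<delta> by (simp add: power2_eq_square)
  finally show ?thesis unfolding D_def A_def B_def by (simp only: mult.assoc)
qed

section \<open>The variance of the Stein kernel\<close>

text \<open>
Machin's formula and \<open>arctan x \<le> x\<close> give \<open>\<pi> \<le> 16 * (1/5)\<close>.
\<close>

lemma pi_le: "pi \<le> 16 / 5"
proof -
  have "arctan (1 / 5) \<le> (1 / 5 :: real)"
  proof -
    have "(\<lambda>x. x - arctan x) 0 \<le> (\<lambda>x. x - arctan x) (1 / 5 :: real)"
    proof (rule DERIV_nonneg_imp_nondecreasing[where f = "\<lambda>x. x - arctan x"])
      fix x :: real
      have "((\<lambda>x. x - arctan x) has_real_derivative 1 - inverse (1 + x\<^sup>2)) (at x)"
        by (auto intro!: derivative_eq_intros)
      moreover have "0 \<le> 1 - inverse (1 + x\<^sup>2)" by (simp add: inverse_le_1_iff)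
      ultimately show "\<exists>y. ((\<lambda>x. x - arctan x) has_real_derivative y) (at x) \<and> 0 \<le> y" by blast
    qed simp
    then show ?thesis by simp
  qed
  moreover have "0 \<le> arctan (1 / 239 :: real)" by simp
  ultimately show ?thesis using machin by linarith
qed

text \<open>
Twice the variance is the second moment of \<open>T (snd p) - T (fst p)\<close>. Telescoping along \<open>n\<close> arcs of equal
length, the Cauchy-Schwarz inequality for sums gives a factor \<open>n\<close>, and the \<open>n\<close> summands have equal
expectations by rotation invariance.
\<close>

lemma gauss_variance_le_increments:
  fixes T :: "'a::euclidean_space \<Rightarrow> real"
  assumes T: "tame T" and n: "0 < n"
  shows "2 * (\<integral>x. (T x - (\<integral>y. T y \<partial>gauss))\<^sup>2 \<partial>gauss)
    \<le> (real n)\<^sup>2 * (\<integral>p. (T (fst (rot (pi / (2 * n)) p)) - T (fst p))\<^sup>2 \<partial>gauss2)"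
proof -
  note tc [tame_intros] = tame_compose[OF T]
  note m2 = moment_measure_gauss2 and mg = moment_measure_gauss
  interpret g: prob_space "gauss :: 'a measure" by (rule prob_space_gauss)
  define \<epsilon> where "\<epsilon> = pi / (2 * n)"
  define I where "I = (\<integral>p. (T (fst (rot \<epsilon> p)) - T (fst p))\<^sup>2 \<partial>gauss2)"
  define m where "m = (\<integral>y. T y \<partial>gauss)"
  have iT: "integrable gauss T" "integrable gauss (\<lambda>x. (T x)\<^sup>2)"
    by (intro tame_integrable[OF mg] tame_intros)+
  have "2 * (\<integral>x. (T x - m)\<^sup>2 \<partial>gauss) = (\<integral>p. (T (snd p) - T (fst p))\<^sup>2 \<partial>gauss2)"
  proof -
    have "(\<integral>p. (T (snd p) - T (fst p))\<^sup>2 \<partial>gauss2) = (\<integral>x. (\<integral>y. (T y - T x)\<^sup>2 \<partial>gauss) \<partial>gauss)"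
      by (subst tame_Fubini(3)[OF mg mg, symmetric]) (auto intro!: tame_intros)
    also have "\<dots> = (\<integral>x. (\<integral>y. (T y)\<^sup>2 \<partial>gauss) - 2 * m * T x + (T x)\<^sup>2 \<partial>gauss)"
    proof (rule Bochner_Integration.integral_cong[OF refl])
      fix x
      have "(\<integral>y. (T y - T x)\<^sup>2 \<partial>gauss) = (\<integral>y. (T y)\<^sup>2 - (2 * T x) * T y + (T x)\<^sup>2 \<partial>gauss)"
        by (intro Bochner_Integration.integral_cong refl) (simp add: power2_eq_square algebra_simps)
      also have "\<dots> = (\<integral>y. (T y)\<^sup>2 \<partial>gauss) - (2 * T x) * m + (T x)\<^sup>2"
        using iT g.prob_space by (simp add: m_def)
      finally show "(\<integral>y. (T y - T x)\<^sup>2 \<partial>gauss) = (\<integral>y. (T y)\<^sup>2 \<partial>gauss) - 2 * m * T x + (T x)\<^sup>2" by simp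
    qed
    also have "\<dots> = 2 * (\<integral>y. (T y)\<^sup>2 \<partial>gauss) - 2 * m * m"
      using iT g.prob_space by (simp add: m_def)
    also have "\<dots> = 2 * (\<integral>x. (T x)\<^sup>2 - 2 * m * T x + m\<^sup>2 \<partial>gauss)"
      using iT g.prob_space by (simp add: power2_eq_square flip: m_def)
    also have "(\<integral>x. (T x)\<^sup>2 - 2 * m * T x + m\<^sup>2 \<partial>gauss) = (\<integral>x. (T x - m)\<^sup>2 \<partial>gauss)"
      by (intro Bochner_Integration.integral_cong refl) (simp add: power2_eq_square algebra_simps)
    finally show ?thesis ..
  qed
  also have "\<dots> \<le> (\<integral>p. real n * (\<Sum>k<n. (T (fst (rot (real (Suc k) * \<epsilon>) p)) - T (fst (rot (real k * \<epsilon>) p)))\<^sup>2) \<partial>gauss2)"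
  proof (rule integral_tame_mono[OF m2])
    show "tame (\<lambda>p. (T (snd p) - T (fst p))\<^sup>2)" by (intro tame_intros)
    have "tame (\<lambda>p. \<Sum>k<j. (T (fst (rot (real (Suc k) * \<epsilon>) p)) - T (fst (rot (real k * \<epsilon>) p)))\<^sup>2)" for j
      by (induction j) (auto intro!: tame_intros simp del: of_nat_Suc)
    then show "tame (\<lambda>p. real n * (\<Sum>k<n. (T (fst (rot (real (Suc k) * \<epsilon>) p)) - T (fst (rot (real k * \<epsilon>) p)))\<^sup>2))"
      by (intro tame_intros)
    fix p :: "'a \<times> 'a"
    have "(\<Sum>k<n. T (fst (rot (real (Suc k) * \<epsilon>) p)) - T (fst (rot (real k * \<epsilon>) p)))
        = T (fst (rot (real n * \<epsilon>) p)) - T (fst (rot (real 0 * \<epsilon>) p))"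
      by (rule sum_lessThan_telescope)
    also have "\<dots> = T (snd p) - T (fst p)" using n by (simp add: \<epsilon>_def rot_pi_half)
    finally show "(T (snd p) - T (fst p))\<^sup>2 \<le> real n * (\<Sum>k<n. (T (fst (rot (real (Suc k) * \<epsilon>) p)) - T (fst (rot (real k * \<epsilon>) p)))\<^sup>2)"
      using sum_squared_le_sum_of_squares[of "\<lambda>k. T (fst (rot (real (Suc k) * \<epsilon>) p)) - T (fst (rot (real k * \<epsilon>) p))" "{..<n}"]
      by (simp add: mult.commute del: of_nat_Suc)
  qed
  also have "\<dots> = real n * (\<Sum>k<n. (\<integral>p. (T (fst (rot (real (Suc k) * \<epsilon>) p)) - T (fst (rot (real k * \<epsilon>) p)))\<^sup>2 \<partial>gauss2))"
    by (subst integral_mult_right_zero, subst Bochner_Integration.integral_sum)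
       (auto intro!: tame_integrable[OF m2] tame_intros)
  also have "\<dots> = real n * (\<Sum>k<n. I)"
  proof -
    have "(\<integral>p. (T (fst (rot (real (Suc k) * \<epsilon>) p)) - T (fst (rot (real k * \<epsilon>) p)))\<^sup>2 \<partial>gauss2) = I" if "k < n" for k
    proof -
      have "real k * \<epsilon> \<le> real n * \<epsilon>" using that by (intro mult_right_mono) (auto simp: \<epsilon>_def)
      then have k: "real k * \<epsilon> \<le> pi / 2" "0 \<le> real k * \<epsilon>" using n by (auto simp: \<epsilon>_def)
      have "I = (\<integral>p. (T (fst (rot \<epsilon> (rot (real k * \<epsilon>) p))) - T (fst (rot (real k * \<epsilon>) p)))\<^sup>2 \<partial>gauss2)"
        unfolding I_def
        using integral_rot[of "\<lambda>p. (T (fst (rot \<epsilon> p)) - T (fst p))\<^sup>2" "real k * \<epsilon>"] cos_ne_minus_one[OF k(2,1)]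
        by (simp add: tame_intros)
      moreover have "\<epsilon> + real k * \<epsilon> = real (Suc k) * \<epsilon>" by (simp add: algebra_simps)
      ultimately show ?thesis by (simp only: rot_add)
    qed
    then show ?thesis by simp
  qed
  also have "\<dots> = (real n)\<^sup>2 * I" by (simp add: power2_eq_square)
  finally show ?thesis by (simp add: m_def I_def \<epsilon>_def)
qed

text \<open>
A 1-Lipschitz gradient field \<open>R\<close> and its potential \<open>\<psi>\<close>. The gradient is described by a quadratic error bound
because the second difference argument uses it in this quantitative form, and because it is what
the minimality of the projection gives directly.
\<close>

locale potential =
  fixes \<psi> :: "'a::euclidean_space \<Rightarrow> real" and R :: "'a \<Rightarrow> 'a"
  assumes quad: "\<And>x y. \<bar>\<psi> y - \<psi> x - R x \<bullet> (y - x)\<bar> \<le> 2 * (norm (y - x))\<^sup>2"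
    and lip: "\<And>x y. norm (R x - R y) \<le> norm (x - y)"
begin

lemma der: "(\<psi> has_derivative (\<lambda>h. R x \<bullet> h)) (at x)"
proof -
  have "\<exists>d>0. \<forall>y. norm (y - x) < d \<longrightarrow> norm (\<psi> y - \<psi> x - R x \<bullet> (y - x)) \<le> e * norm (y - x)" if "0 < e" for e
  proof (intro exI[of _ "e / 2"] conjI allI impI)
    fix y assume "norm (y - x) < e / 2"
    then have "(2 * norm (y - x)) * norm (y - x) \<le> e * norm (y - x)" by (intro mult_right_mono) auto
    then show "norm (\<psi> y - \<psi> x - R x \<bullet> (y - x)) \<le> e * norm (y - x)"
      using quad[of y x] by (simp add: power2_eq_square)
  qed (use that in simp)
  then show ?thesis by (simp add: has_derivative_at_alt bounded_linear_inner_right)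
qed

lemma tame_R: "tame R"
  by (rule tame_lipschitz[of R 1]) (use lip in simp)

lemma tame_psi: "tame \<psi>"
proof (rule tameI)
  show "continuous_on UNIV \<psi>"
    using der by (intro differentiable_imp_continuous_on) (auto simp: differentiable_on_def differentiable_def intro: has_derivative_at_withinI)
  fix x :: 'a
  have 1: "norm x \<le> (1 + norm x)\<^sup>2" "1 \<le> (1 + norm x)\<^sup>2" "(norm x)\<^sup>2 \<le> (1 + norm x)\<^sup>2"
    by (auto simp: power2_eq_square algebra_simps)
  have "\<bar>\<psi> x\<bar> \<le> \<bar>\<psi> 0\<bar> + \<bar>R 0 \<bullet> x\<bar> + 2 * (norm x)\<^sup>2" using quad[of x 0] by simp
  also have "\<bar>R 0 \<bullet> x\<bar> \<le> norm (R 0) * norm x" by (rule Cauchy_Schwarz_ineq2)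
  also have "\<bar>\<psi> 0\<bar> + norm (R 0) * norm x + 2 * (norm x)\<^sup>2 \<le> \<bar>\<psi> 0\<bar> * (1 + norm x)\<^sup>2 + norm (R 0) * (1 + norm x)\<^sup>2 + 2 * (1 + norm x)\<^sup>2"
    using 1 mult_left_mono[OF 1(2), of "\<bar>\<psi> 0\<bar>"] by (intro add_mono mult_left_mono) auto
  finally show "norm (\<psi> x) \<le> (\<bar>\<psi> 0\<bar> + norm (R 0) + 2) * (1 + norm x) ^ 2"
    by (simp add: algebra_simps)
qed

lemmas tame_R' [tame_intros] = tame_compose[OF tame_R]

lemmas tame_psi' [tame_intros] = tame_compose[OF tame_psi]

text \<open>
With \<open>F = 2 \<psi> - E (2 \<psi>)\<close>, the field \<open>2 V\<close> is \<open>- \<nabla> L\<^sup>-\<^sup>1 F\<close> for the Ornstein-Uhlenbeck generator \<open>L\<close>.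
\<close>

definition V :: "'a \<Rightarrow> 'a" where
  "V x = (\<integral>q. R (cos (fst q) *\<^sub>R x + sin (fst q) *\<^sub>R snd q) \<partial>arc_measure)"

text \<open>
The multiple \<open>4 T\<close> is the pairing of \<open>\<nabla> F\<close> with \<open>- \<nabla> L\<^sup>-\<^sup>1 F\<close>; its conditional expectation given \<open>F\<close>
is the Stein kernel of \<open>F\<close>.
\<close>

definition T :: "'a \<Rightarrow> real" where
  "T x = R x \<bullet> V x"

lemma integrable_V: "integrable arc_measure (\<lambda>q. R (cos (fst q) *\<^sub>R x + sin (fst q) *\<^sub>R snd q))"
  by (intro tame_integrable[OF moment_measure_arc] tame_intros)

lemma V_lip: "norm (V x - V y) \<le> norm (x - y)"
proof -
  interpret a: prob_space "arc_measure :: (real \<times> 'a) measure" by (rule prob_space_arc)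
  have "norm (V x - V y) = norm (\<integral>q. R (cos (fst q) *\<^sub>R x + sin (fst q) *\<^sub>R snd q) - R (cos (fst q) *\<^sub>R y + sin (fst q) *\<^sub>R snd q) \<partial>arc_measure)"
    unfolding V_def using integrable_V by simp
  also have "\<dots> \<le> (\<integral>q. norm (R (cos (fst q) *\<^sub>R x + sin (fst q) *\<^sub>R snd q) - R (cos (fst q) *\<^sub>R y + sin (fst q) *\<^sub>R snd q)) \<partial>arc_measure)"
    by (rule integral_norm_bound)
  also have "\<dots> \<le> (\<integral>q. norm (x - y) \<partial>(arc_measure :: (real \<times> 'a) measure))"
  proof (rule integral_tame_mono[OF moment_measure_arc])
    fix q :: "real \<times> 'a"
    have "norm (R (cos (fst q) *\<^sub>R x + sin (fst q) *\<^sub>R snd q) - R (cos (fst q) *\<^sub>R y + sin (fst q) *\<^sub>R snd q))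
        \<le> norm (cos (fst q) *\<^sub>R (x - y))"
      using lip[of "cos (fst q) *\<^sub>R x + sin (fst q) *\<^sub>R snd q" "cos (fst q) *\<^sub>R y + sin (fst q) *\<^sub>R snd q"]
      by (simp add: scaleR_diff_right)
    also have "\<dots> \<le> norm (x - y)" by (simp add: mult_left_le_one_le)
    finally show "norm (R (cos (fst q) *\<^sub>R x + sin (fst q) *\<^sub>R snd q) - R (cos (fst q) *\<^sub>R y + sin (fst q) *\<^sub>R snd q)) \<le> norm (x - y)" .
  qed (intro tame_intros)+
  also have "\<dots> = norm (x - y)" using a.prob_space by simp
  finally show ?thesis .
qed

lemma tame_V: "tame V"
  by (rule tame_lipschitz[of V 1]) (use V_lip in simp)

lemmas tame_V' [tame_intros] = tame_compose[OF tame_V]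

lemma tame_T: "tame T"
  unfolding T_def using tame_R tame_V by (intro tame_intros)

definition r2 :: real where "r2 = (\<integral>x. (norm (R x))\<^sup>2 \<partial>gauss)"

lemma r2_nonneg: "0 \<le> r2" by (simp add: r2_def)

text \<open>
Jensen's inequality, and the fact that \<open>cos t x + sin t z\<close> is again standard Gaussian for each angle \<open>t\<close>.
\<close>

lemma V_second_moment: "(\<integral>x. (norm (V x))\<^sup>2 \<partial>gauss) \<le> r2"
proof -
  interpret a: prob_space "arc_measure :: (real \<times> 'a) measure" by (rule prob_space_arc)
  interpret s: prob_space "seg (pi / 2) sin" by (rule prob_space_seg_sin)
  let ?u = "\<lambda>x q. (norm (R (cos (fst q) *\<^sub>R x + sin (fst q) *\<^sub>R snd q)))\<^sup>2"
  have tu: "tame (\<lambda>z. ?u (fst z) (snd z))" by (intro tame_intros)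
  have "(\<integral>x. (norm (V x))\<^sup>2 \<partial>gauss) \<le> (\<integral>x. (\<integral>q. ?u x q \<partial>arc_measure) \<partial>gauss)"
  proof (rule integral_mono)
    show "integrable gauss (\<lambda>x. (norm (V x))\<^sup>2)"
      by (intro tame_integrable[OF moment_measure_gauss] tame_intros)
    show "integrable gauss (\<lambda>x. \<integral>q. ?u x q \<partial>arc_measure)"
      using tame_Fubini(1)[OF moment_measure_gauss moment_measure_arc tu] by simp
    fix x
    have "norm (V x) \<le> (\<integral>q. norm (R (cos (fst q) *\<^sub>R x + sin (fst q) *\<^sub>R snd q)) \<partial>arc_measure)"
      unfolding V_def by (rule integral_norm_bound)
    then have "(norm (V x))\<^sup>2 \<le> (\<integral>q. norm (R (cos (fst q) *\<^sub>R x + sin (fst q) *\<^sub>R snd q)) \<partial>arc_measure)\<^sup>2"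
      by (intro power_mono) auto
    also have "\<dots> \<le> 1 * (\<integral>q. ?u x q \<partial>arc_measure)"
      by (rule square_integral_le[OF moment_measure_arc]) (auto intro!: tame_intros simp: a.prob_space)
    finally show "(norm (V x))\<^sup>2 \<le> (\<integral>q. ?u x q \<partial>arc_measure)" by simp
  qed
  also have "\<dots> = (\<integral>t. (\<integral>p. (norm (R (fst (rot t p))))\<^sup>2 \<partial>gauss2) \<partial>(seg (pi / 2) sin))"
    using integral_arc[OF tu] by (simp add: rot_def)
  also have "\<dots> = (\<integral>t. r2 \<partial>(seg (pi / 2) sin))"
  proof (rule integral_cong_AE)
    have "integrable (seg (pi / 2) sin) (\<lambda>t. \<integral>p. (norm (R (fst (rot t p))))\<^sup>2 \<partial>gauss2)"
      using tame_Fubini(1)[OF moment_measure_seg_sin moment_measure_gauss2, of "\<lambda>z. (norm (R (fst (rot (fst z) (snd z)))))\<^sup>2"]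
      by (simp add: tame_intros)
    then show "(\<lambda>t. \<integral>p. (norm (R (fst (rot t p))))\<^sup>2 \<partial>gauss2) \<in> borel_measurable (seg (pi / 2) sin)" by simp
    have "(\<integral>p. (norm (R (fst (rot t p))))\<^sup>2 \<partial>gauss2) = r2" if "0 \<le> t" "t \<le> pi / 2" for t
    proof -
      have "(\<integral>p. (norm (R (fst (rot t p))))\<^sup>2 \<partial>gauss2) = (\<integral>p. (norm (R (fst p)))\<^sup>2 \<partial>gauss2)"
        by (rule integral_rot[OF _ cos_ne_minus_one[OF that]]) (intro tame_intros)
      also have "\<dots> = r2" unfolding r2_def by (rule gauss2_fst) (intro tame_intros tame_R)
      finally show ?thesis .
    qed
    then show "AE t in seg (pi / 2) sin. (\<integral>p. (norm (R (fst (rot t p))))\<^sup>2 \<partial>gauss2) = r2"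
      unfolding seg_def by (subst AE_density) (auto split: split_indicator)
  qed simp
  also have "\<dots> = r2" using s.prob_space by simp
  finally show ?thesis .
qed

text \<open>
For fixed \<open>t\<close> and \<open>z\<close>, the field that is averaged in the definition of \<open>V\<close> is again the gradient of a
function, and \<open>gradient_increment\<close> applies to it with Lipschitz constant \<open>\<bar>cos t\<bar>\<close>.
\<close>

lemma potential_slice:
  assumes "cos t \<noteq> 0"
  shows "((\<lambda>x. \<psi> (cos t *\<^sub>R x + sin t *\<^sub>R z) / cos t) has_derivative (\<lambda>h. R (cos t *\<^sub>R x + sin t *\<^sub>R z) \<bullet> h)) (at x)"
    and "\<bar>\<psi> (cos t *\<^sub>R y + sin t *\<^sub>R z) / cos t - \<psi> (cos t *\<^sub>R x + sin t *\<^sub>R z) / cos t - R (cos t *\<^sub>R x + sin t *\<^sub>R z) \<bullet> (y - x)\<bar> \<le> 2 * (norm (y - x))\<^sup>2"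
proof -
  have "((\<lambda>x. cos t *\<^sub>R x + sin t *\<^sub>R z) has_derivative (\<lambda>h. cos t *\<^sub>R h)) (at x)"
    by (auto intro!: derivative_eq_intros)
  from has_derivative_compose[OF this der]
  have "((\<lambda>x. \<psi> (cos t *\<^sub>R x + sin t *\<^sub>R z)) has_derivative (\<lambda>h. cos t * (R (cos t *\<^sub>R x + sin t *\<^sub>R z) \<bullet> h))) (at x)"
    by simp
  from has_derivative_divide'[OF this has_derivative_const[of "cos t"] assms]
  show "((\<lambda>x. \<psi> (cos t *\<^sub>R x + sin t *\<^sub>R z) / cos t) has_derivative (\<lambda>h. R (cos t *\<^sub>R x + sin t *\<^sub>R z) \<bullet> h)) (at x)"
    using assms by (simp add: field_simps)
next
  let ?A = "\<lambda>x. cos t *\<^sub>R x + sin t *\<^sub>R z"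
  have A: "?A y - ?A x = cos t *\<^sub>R (y - x)" by (simp add: scaleR_diff_right)
  have "\<bar>\<psi> (?A y) - \<psi> (?A x) - cos t * (R (?A x) \<bullet> (y - x))\<bar> \<le> 2 * ((cos t)\<^sup>2 * (norm (y - x))\<^sup>2)"
    using quad[of "?A y" "?A x"] unfolding A by (simp add: power_mult_distrib)
  then have "\<bar>\<psi> (?A y) - \<psi> (?A x) - cos t * (R (?A x) \<bullet> (y - x))\<bar> / \<bar>cos t\<bar> \<le> 2 * ((cos t)\<^sup>2 * (norm (y - x))\<^sup>2) / \<bar>cos t\<bar>"
    by (intro divide_right_mono) auto
  also have "2 * ((cos t)\<^sup>2 * (norm (y - x))\<^sup>2) / \<bar>cos t\<bar> = 2 * (\<bar>cos t\<bar> * (norm (y - x))\<^sup>2)"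
  proof -
    have "2 * (k\<^sup>2 * n) / k = 2 * (k * n)" if "k \<noteq> 0" for k n :: real
      using that by (simp add: power2_eq_square)
    from this[of "\<bar>cos t\<bar>"] show ?thesis using assms by simp
  qed
  also have "\<dots> \<le> 2 * (1 * (norm (y - x))\<^sup>2)" by (intro mult_left_mono mult_right_mono) auto
  also have "\<bar>\<psi> (?A y) - \<psi> (?A x) - cos t * (R (?A x) \<bullet> (y - x))\<bar> / \<bar>cos t\<bar>
      = \<bar>\<psi> (?A y) / cos t - \<psi> (?A x) / cos t - R (?A x) \<bullet> (y - x)\<bar>"
    using assms by (simp add: abs_divide[symmetric] diff_divide_distrib)
  finally show "\<bar>\<psi> (?A y) / cos t - \<psi> (?A x) / cos t - R (?A x) \<bullet> (y - x)\<bar> \<le> 2 * (norm (y - x))\<^sup>2" by simp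
qed

text \<open>
Jensen's inequality moves the average over the angle and \<open>z\<close> outside the square. For each fixed value
\<open>gradient_increment\<close> applies, with the factor \<open>cos\<^sup>2 t\<close>, whose average is 1/3. If \<open>cos t = 0\<close>
the field is constant in \<open>x\<close> and its increment vanishes.
\<close>

lemma V_increment:
  assumes \<epsilon>: "0 < \<epsilon>" "\<epsilon> \<le> pi / 2"
  shows "(\<integral>p. ((V (fst (rot \<epsilon> p)) - V (fst p)) \<bullet> R (fst p))\<^sup>2 \<partial>gauss2)
     \<le> 11 / 30 * \<epsilon>\<^sup>2 * r2 + 11 * \<epsilon> ^ 4 * (\<integral>p. (arc_error R p)\<^sup>2 \<partial>gauss2)"
proof -
  interpret a: prob_space "arc_measure :: (real \<times> 'a) measure" by (rule prob_space_arc)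
  interpret g: prob_space "gauss :: 'a measure" by (rule prob_space_gauss)
  define A where "A = (\<lambda>x (q :: real \<times> 'a). cos (fst q) *\<^sub>R x + sin (fst q) *\<^sub>R snd q :: 'a)"
  define d where "d = (\<lambda>p q. (R (A (fst (rot \<epsilon> p)) q) - R (A (fst p) q)) \<bullet> R (fst p))"
  define K where "K = (\<integral>p. (arc_error R p)\<^sup>2 \<partial>gauss2)"
  note m2 = moment_measure_gauss2 and ma = moment_measure_arc
  have td: "tame (\<lambda>z. (d (fst z) (snd z))\<^sup>2)" unfolding d_def A_def by (intro tame_intros)
  have td': "tame (\<lambda>q. d p q)" for p unfolding d_def A_def by (intro tame_intros)
  have "(\<integral>p. ((V (fst (rot \<epsilon> p)) - V (fst p)) \<bullet> R (fst p))\<^sup>2 \<partial>gauss2) \<le> (\<integral>p. (\<integral>q. (d p q)\<^sup>2 \<partial>arc_measure) \<partial>gauss2)"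
  proof (rule integral_mono)
    show "integrable gauss2 (\<lambda>p. ((V (fst (rot \<epsilon> p)) - V (fst p)) \<bullet> R (fst p))\<^sup>2)"
      by (intro tame_integrable[OF m2] tame_intros)
    show "integrable gauss2 (\<lambda>p. \<integral>q. (d p q)\<^sup>2 \<partial>arc_measure)"
      using tame_Fubini(1)[OF m2 ma td] by simp
    fix p :: "'a \<times> 'a"
    have "(V (fst (rot \<epsilon> p)) - V (fst p)) \<bullet> R (fst p) = (\<integral>q. d p q \<partial>arc_measure)"
      unfolding V_def d_def A_def using integrable_V
      by (subst integral_inner_left) auto
    then show "((V (fst (rot \<epsilon> p)) - V (fst p)) \<bullet> R (fst p))\<^sup>2 \<le> (\<integral>q. (d p q)\<^sup>2 \<partial>arc_measure)"
      using square_integral_le[OF ma td', of 1 p] by (simp add: a.prob_space)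
  qed
  also have "\<dots> = (\<integral>q. (\<integral>p. (d p q)\<^sup>2 \<partial>gauss2) \<partial>arc_measure)"
    using tame_Fubini(3,4)[OF m2 ma td] by simp
  also have "\<dots> \<le> (\<integral>q. 11 / 10 * (cos (fst q))\<^sup>2 * \<epsilon>\<^sup>2 * r2 + 11 * \<epsilon> ^ 4 * K \<partial>(arc_measure :: (real \<times> 'a) measure))"
  proof (rule integral_mono)
    show "integrable arc_measure (\<lambda>q. \<integral>p. (d p q)\<^sup>2 \<partial>gauss2)"
      using tame_Fubini(2)[OF m2 ma td] by simp
    show "integrable arc_measure (\<lambda>q :: real \<times> 'a. 11 / 10 * (cos (fst q))\<^sup>2 * \<epsilon>\<^sup>2 * r2 + 11 * \<epsilon> ^ 4 * K)"
      by (intro tame_integrable[OF ma] tame_intros)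
    fix q :: "real \<times> 'a"
    show "(\<integral>p. (d p q)\<^sup>2 \<partial>gauss2) \<le> 11 / 10 * (cos (fst q))\<^sup>2 * \<epsilon>\<^sup>2 * r2 + 11 * \<epsilon> ^ 4 * K"
    proof (cases "cos (fst q) = 0")
      case True
      then show ?thesis by (simp add: d_def A_def K_def)
    next
      case False
      have "norm (R (A x q) - R (A y q)) \<le> \<bar>cos (fst q)\<bar> * norm (x - y)" for x y
      proof -
        have "A x q - A y q = cos (fst q) *\<^sub>R (x - y)" by (simp add: A_def scaleR_diff_right)
        then show ?thesis using lip[of "A x q" "A y q"] by simp
      qed
      from gradient_increment[OF potential_slice[OF False, where z = "snd q"] this[unfolded A_def] _ _ lip \<epsilon>]
      show ?thesis unfolding d_def A_def K_def r2_def by simp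
    qed
  qed
  also have "\<dots> = 11 / 10 * (\<integral>q. (cos (fst q))\<^sup>2 \<partial>(arc_measure :: (real \<times> 'a) measure)) * \<epsilon>\<^sup>2 * r2 + 11 * \<epsilon> ^ 4 * K"
  proof -
    have "integrable arc_measure (\<lambda>q :: real \<times> 'a. (cos (fst q))\<^sup>2)"
      by (intro tame_integrable[OF ma] tame_intros)
    then show ?thesis using a.prob_space by simp
  qed
  also have "(\<integral>q. (cos (fst q))\<^sup>2 \<partial>(arc_measure :: (real \<times> 'a) measure)) = 1 / 3"
    using tame_Fubini(3)[OF moment_measure_seg_sin moment_measure_gauss, of "\<lambda>q :: real \<times> 'a. (cos (fst q))\<^sup>2"] g.prob_space
    by (simp add: tame_intros arc_measure_def integral_seg_sin_cos_square)
  finally show ?thesis by (simp add: K_def)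
qed

text \<open>
By the product rule an increment of \<open>R \<bullet> V\<close> consists of an increment of \<open>R\<close>, an increment of \<open>V\<close> and a product
of two increments, which is \<open>O(\<epsilon>\<^sup>2)\<close>. The weights 3/2 and 3 of the first two terms nearly
balance their second moments, which are in the proportion 3 to 1, and
\<open>121/40 = (11/10)\<^sup>2 (3/2 + 3 * 1/3)\<close>.
\<close>

lemma T_increment:
  obtains K where "\<And>\<epsilon>. 0 < \<epsilon> \<Longrightarrow> \<epsilon> \<le> pi / 2 \<Longrightarrow>
    (\<integral>p. (T (fst (rot \<epsilon> p)) - T (fst p))\<^sup>2 \<partial>gauss2) \<le> 121 / 40 * \<epsilon>\<^sup>2 * r2 + K * \<epsilon> ^ 4"
proof -
  define E1 where "E1 = (\<integral>p. (arc_error V p)\<^sup>2 \<partial>gauss2)"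
  define E2 where "E2 = (\<integral>p. (arc_error R p)\<^sup>2 \<partial>gauss2)"
  define E3 where "E3 = (\<integral>p. ((norm (fst p) + norm (snd p)) ^ 4) \<partial>(gauss2 :: ('a \<times> 'a) measure))"
  note m2 = moment_measure_gauss2
  have "(\<integral>p. (T (fst (rot \<epsilon> p)) - T (fst p))\<^sup>2 \<partial>gauss2) \<le> 121 / 40 * \<epsilon>\<^sup>2 * r2 + (363 / 20 * E1 + 363 / 10 * E2 + 11 * E3) * \<epsilon> ^ 4"
    if \<epsilon>: "0 < \<epsilon>" "\<epsilon> \<le> pi / 2" for \<epsilon>
  proof -
    define a where "a = (\<lambda>p. (R (fst (rot \<epsilon> p)) - R (fst p)) \<bullet> V (fst p))"
    define b where "b = (\<lambda>p. (V (fst (rot \<epsilon> p)) - V (fst p)) \<bullet> R (fst p))"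
    have ta: "tame a" and tb: "tame b" unfolding a_def b_def by (intro tame_intros)+
    have Ia: "integrable gauss2 (\<lambda>p. (a p)\<^sup>2)" and Ib: "integrable gauss2 (\<lambda>p. (b p)\<^sup>2)"
      using ta tb by (auto intro!: tame_integrable[OF m2] tame_intros)
    have Ie: "integrable gauss2 (\<lambda>p :: 'a \<times> 'a. (norm (fst p) + norm (snd p)) ^ 4)"
      by (intro tame_integrable[OF m2] tame_intros)
    have pw: "(T (fst (rot \<epsilon> p)) - T (fst p))\<^sup>2 \<le> 33 / 20 * (a p)\<^sup>2 + 33 / 10 * (b p)\<^sup>2 + 11 * \<epsilon> ^ 4 * (norm (fst p) + norm (snd p)) ^ 4" for p
    proof -
      let ?y = "fst (rot \<epsilon> p)" and ?x = "fst p" and ?r = "norm (fst p) + norm (snd p)"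
      define e where "e = (R ?y - R ?x) \<bullet> (V ?y - V ?x)"
      have "\<bar>e\<bar> \<le> norm (R ?y - R ?x) * norm (V ?y - V ?x)" unfolding e_def by (rule Cauchy_Schwarz_ineq2)
      also have "\<dots> \<le> (\<epsilon> * ?r) * (\<epsilon> * ?r)"
        using lip[of ?y ?x] V_lip[of ?y ?x] norm_fst_rot_diff_le[of \<epsilon> p] \<epsilon>
        by (intro mult_mono) (auto intro: order_trans)
      finally have "\<bar>e\<bar>\<^sup>2 \<le> ((\<epsilon> * ?r) * (\<epsilon> * ?r))\<^sup>2" by (intro power_mono) auto
      then have e2: "e\<^sup>2 \<le> \<epsilon> ^ 4 * ?r ^ 4" by (simp add: power_mult_distrib power2_eq_square power4_eq_xxxx mult_ac)
      have "T ?y - T ?x = (a p + b p) + e"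
        by (simp add: T_def a_def b_def e_def inner_simps inner_commute)
      then have "(T ?y - T ?x)\<^sup>2 \<le> 11 / 10 * (a p + b p)\<^sup>2 + 11 * e\<^sup>2" by (simp only: square_add_le)
      moreover have "(a p + b p)\<^sup>2 \<le> 3 / 2 * (a p)\<^sup>2 + 3 * (b p)\<^sup>2"
      proof -
        have "0 \<le> (a p - 2 * b p)\<^sup>2" by simp
        then show ?thesis by (simp add: power2_eq_square algebra_simps)
      qed
      ultimately show ?thesis using e2 by linarith
    qed
    have "(\<integral>p. (T (fst (rot \<epsilon> p)) - T (fst p))\<^sup>2 \<partial>gauss2)
        \<le> (\<integral>p. 33 / 20 * (a p)\<^sup>2 + 33 / 10 * (b p)\<^sup>2 + 11 * \<epsilon> ^ 4 * (norm (fst p) + norm (snd p)) ^ 4 \<partial>gauss2)"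
      by (intro integral_tame_mono[OF m2] pw tame_intros ta tb tame_compose[OF tame_T])
    also have "\<dots> = 33 / 20 * (\<integral>p. (a p)\<^sup>2 \<partial>gauss2) + 33 / 10 * (\<integral>p. (b p)\<^sup>2 \<partial>gauss2) + 11 * \<epsilon> ^ 4 * E3"
      unfolding E3_def using Ia Ib Ie by simp
    also have "\<dots> \<le> 33 / 20 * (11 / 10 * \<epsilon>\<^sup>2 * r2 + 11 * \<epsilon> ^ 4 * E1) + 33 / 10 * (11 / 30 * \<epsilon>\<^sup>2 * r2 + 11 * \<epsilon> ^ 4 * E2) + 11 * \<epsilon> ^ 4 * E3"
    proof (intro add_mono mult_left_mono order_refl)
      have "(\<integral>p. (a p)\<^sup>2 \<partial>gauss2) \<le> 11 / 10 * 1\<^sup>2 * \<epsilon>\<^sup>2 * (\<integral>x. (norm (V x))\<^sup>2 \<partial>gauss) + 11 * \<epsilon> ^ 4 * E1"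
        unfolding a_def E1_def
        by (rule gradient_increment[OF der quad _ _ _ V_lip \<epsilon>]) (use lip in auto)
      also have "\<dots> \<le> 11 / 10 * \<epsilon>\<^sup>2 * r2 + 11 * \<epsilon> ^ 4 * E1"
        using mult_left_mono[OF V_second_moment, of "11 / 10 * \<epsilon>\<^sup>2"] by simp
      finally show "(\<integral>p. (a p)\<^sup>2 \<partial>gauss2) \<le> 11 / 10 * \<epsilon>\<^sup>2 * r2 + 11 * \<epsilon> ^ 4 * E1" .
      show "(\<integral>p. (b p)\<^sup>2 \<partial>gauss2) \<le> 11 / 30 * \<epsilon>\<^sup>2 * r2 + 11 * \<epsilon> ^ 4 * E2"
        unfolding b_def E2_def by (rule V_increment[OF \<epsilon>])
    qed auto
    also have "\<dots> = 121 / 40 * \<epsilon>\<^sup>2 * r2 + (363 / 20 * E1 + 363 / 10 * E2 + 11 * E3) * \<epsilon> ^ 4"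
      by (simp add: algebra_simps)
    finally show ?thesis .
  qed
  then show thesis by (rule that)
qed

text \<open>
Since \<open>n \<epsilon> = \<pi> / 2\<close>, the error term of order \<open>\<epsilon>\<^sup>4\<close> vanishes as \<open>n\<close> tends to infinity and
\<open>2 Var T \<le> 121/40 * (\<pi> / 2)\<^sup>2 * r2\<close> remains. With \<open>\<pi> \<le> 16/5\<close> the coefficient is below 8.
\<close>

lemma T_variance: "(\<integral>x. (T x - (\<integral>y. T y \<partial>gauss))\<^sup>2 \<partial>gauss) \<le> 4 * r2"
proof -
  obtain K where K: "\<And>\<epsilon>. 0 < \<epsilon> \<Longrightarrow> \<epsilon> \<le> pi / 2 \<Longrightarrow>
    (\<integral>p. (T (fst (rot \<epsilon> p)) - T (fst p))\<^sup>2 \<partial>gauss2) \<le> 121 / 40 * \<epsilon>\<^sup>2 * r2 + K * \<epsilon> ^ 4"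
    by (rule T_increment) blast
  define W where "W = (\<integral>x. (T x - (\<integral>y. T y \<partial>gauss))\<^sup>2 \<partial>gauss)"
  have "2 * W \<le> 121 / 40 * (pi / 2)\<^sup>2 * r2 + K * (pi / 2) ^ 4 * (1 / real n)\<^sup>2" if n: "0 < n" for n
  proof -
    define \<epsilon> where "\<epsilon> = pi / (2 * real n)"
    have \<epsilon>: "0 < \<epsilon>" "\<epsilon> \<le> pi / 2" using n by (auto simp: \<epsilon>_def field_simps)
    have "2 * W \<le> (real n)\<^sup>2 * (121 / 40 * \<epsilon>\<^sup>2 * r2 + K * \<epsilon> ^ 4)"
      using gauss_variance_le_increments[OF tame_T n] mult_left_mono[OF K[OF \<epsilon>], of "(real n)\<^sup>2"]
      unfolding W_def \<epsilon>_def by simp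
    also have "\<dots> = 121 / 40 * (real n * \<epsilon>)\<^sup>2 * r2 + K * (real n * \<epsilon>) ^ 4 * (1 / real n)\<^sup>2"
      using n by (simp add: power_mult_distrib power2_eq_square power4_eq_xxxx field_simps)
    also have "real n * \<epsilon> = pi / 2" using n by (simp add: \<epsilon>_def)
    finally show ?thesis .
  qed
  then have "\<forall>\<^sub>F n in sequentially. 2 * W \<le> 121 / 40 * (pi / 2)\<^sup>2 * r2 + K * (pi / 2) ^ 4 * (1 / real n)\<^sup>2"
    by (intro eventually_sequentiallyI[of 1]) simp
  moreover have "(\<lambda>n. 121 / 40 * (pi / 2)\<^sup>2 * r2 + K * (pi / 2) ^ 4 * (1 / real n)\<^sup>2)
      \<longlonglongrightarrow> 121 / 40 * (pi / 2)\<^sup>2 * r2 + K * (pi / 2) ^ 4 * 0\<^sup>2"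
    by (intro tendsto_intros lim_1_over_n)
  ultimately have "2 * W \<le> 121 / 40 * (pi / 2)\<^sup>2 * r2 + K * (pi / 2) ^ 4 * 0\<^sup>2"
    by (intro tendsto_lowerbound) auto
  also have "\<dots> \<le> 121 / 40 * (8 / 5)\<^sup>2 * r2"
  proof -
    have "(pi / 2)\<^sup>2 \<le> (8 / 5)\<^sup>2" using pi_le by (intro power_mono) auto
    from mult_right_mono[OF this r2_nonneg] show ?thesis by (simp add: mult.commute)
  qed
  also have "\<dots> \<le> 8 * r2"
    using r2_nonneg by (intro mult_right_mono) (auto simp: power2_eq_square)
  finally show ?thesis by (simp add: W_def)
qed

end

section \<open>Stein's equation\<close>

lemma std_normal_density_has_derivative:
  "(std_normal_density has_real_derivative - x * std_normal_density x) (at x)"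
  unfolding std_normal_density_def by (auto intro!: derivative_eq_intros simp: field_simps)

lemma std_normal_density_gt_0: "0 < std_normal_density x"
  by (simp add: normal_density_pos)

lemma continuous_std_normal_density: "continuous_on S std_normal_density"
  using std_normal_density_has_derivative DERIV_isCont
  by (intro continuous_at_imp_continuous_on) blast

lemma std_normal_density_at_top: "(std_normal_density \<longlongrightarrow> 0) at_top"
proof -
  have "filterlim (\<lambda>x::real. x ^ 2 * (1 / 2)) at_top at_top"
    by (intro filterlim_at_top_mult_tendsto_pos[OF tendsto_const] filterlim_pow_at_top filterlim_ident) auto
  then have "filterlim (\<lambda>x::real. - (x ^ 2 * (1 / 2))) at_bot at_top"
    by (simp add: filterlim_uminus_at_bot)
  from filterlim_compose[OF exp_at_bot this]
  have "((\<lambda>x. (1 / sqrt (2 * pi)) * exp (- (x ^ 2 * (1 / 2)))) \<longlongrightarrow> (1 / sqrt (2 * pi)) * 0) at_top"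
    by (intro tendsto_mult tendsto_const)
  then show ?thesis by (simp add: std_normal_density_def[abs_def])
qed

lemma integrable_std_normal_density: "integrable lborel std_normal_density"
  using integrable_std_normal_moment[of 0] by simp

lemma integral_std_normal_density: "(\<integral>x. std_normal_density x \<partial>lborel) = 1"
  using integral_std_normal_moment_even[of 0] by simp

lemma std_normal_first_moment_tail:
  assumes "0 \<le> x"
  shows "(\<integral>t. indicator {x..} t * (t * std_normal_density t) \<partial>lborel) = std_normal_density x"
proof -
  have d: "((\<lambda>t. - std_normal_density t) has_real_derivative t * std_normal_density t) (at t)" for t
    using DERIV_minus[OF std_normal_density_has_derivative[of t]] by simp
  have "(\<integral>\<^sup>+t. ennreal (t * std_normal_density t) * indicator {x..} t \<partial>lborel) = ennreal (0 - - std_normal_density x)"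
  proof (rule nn_integral_FTC_atLeast)
    show "((\<lambda>t. - std_normal_density t) \<longlongrightarrow> 0) at_top"
      using tendsto_minus[OF std_normal_density_at_top] by simp
  qed (use d assms in auto)
  moreover have "(\<integral>t. indicator {x..} t * (t * std_normal_density t) \<partial>lborel)
      = enn2real (\<integral>\<^sup>+t. ennreal (indicator {x..} t * (t * std_normal_density t)) \<partial>lborel)"
    using assms by (intro integral_eq_nn_integral) (auto split: split_indicator)
  moreover have "ennreal (indicator {x..} t * (t * std_normal_density t)) = ennreal (t * std_normal_density t) * indicator {x..} t" for t
    by (auto split: split_indicator)
  ultimately show ?thesis by simp
qed

text \<open>
On the half-line the factor \<open>x\<close> is at most the integration variable \<open>t\<close>, and \<open>t * std_normal_density t\<close>
is the derivative of \<open>- std_normal_density\<close>.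
\<close>

lemma mills_ratio:
  fixes g :: "real \<Rightarrow> real"
  assumes [measurable]: "g \<in> borel_measurable borel" and g: "\<And>t. \<bar>g t\<bar> \<le> std_normal_density t" and x: "0 \<le> x"
  shows "x * \<bar>\<integral>t. indicator {x..} t * g t \<partial>lborel\<bar> \<le> std_normal_density x"
proof -
  have ig: "integrable lborel (\<lambda>t. indicator {x..} t * g t)"
    by (rule Bochner_Integration.integrable_bound[OF integrable_std_normal_density])
       (use g in \<open>auto split: split_indicator simp: abs_mult\<close>)
  have im: "integrable lborel (\<lambda>t. indicator {x..} t * (t * std_normal_density t))"
    by (rule Bochner_Integration.integrable_bound[OF integrable_std_normal_moment[of 1]])
       (auto split: split_indicator simp: abs_mult)
  have "x * \<bar>\<integral>t. indicator {x..} t * g t \<partial>lborel\<bar> = \<bar>\<integral>t. x * (indicator {x..} t * g t) \<partial>lborel\<bar>"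
    using x by (simp add: abs_mult)
  also have "\<dots> \<le> (\<integral>t. \<bar>x * (indicator {x..} t * g t)\<bar> \<partial>lborel)" by (rule integral_abs_bound)
  also have "\<dots> \<le> (\<integral>t. indicator {x..} t * (t * std_normal_density t) \<partial>lborel)"
  proof (rule integral_mono)
    fix t
    have "x * \<bar>g t\<bar> \<le> t * std_normal_density t" if "x \<le> t"
      using that x g[of t] by (intro mult_mono) auto
    then show "\<bar>x * (indicator {x..} t * g t)\<bar> \<le> indicator {x..} t * (t * std_normal_density t)"
      using x by (auto split: split_indicator simp: abs_mult)
  qed (use ig im in auto)
  finally show ?thesis using std_normal_first_moment_tail[OF x] by simp
qed

text \<open>
The solution is \<open>f = k / std_normal_density\<close>, where \<open>k\<close> is the antiderivative of
\<open>(h - \<kappa>) * std_normal_density\<close> that vanishes at both ends of the line. By \<open>mills_ratio\<close>, applied to the upper tail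
for nonnegative \<open>x\<close> and to the reflected lower tail otherwise, \<open>\<bar>x f x\<bar> \<le> 1\<close>; as
\<open>\<bar>h - \<kappa>\<bar> \<le> 1\<close>, Stein's equation itself bounds the derivative by 2.
\<close>

lemma stein_solution:
  fixes h :: "real \<Rightarrow> real"
  assumes cont: "continuous_on UNIV h" and h: "\<And>x. 0 \<le> h x" "\<And>x. h x \<le> 1"
  defines "\<kappa> \<equiv> \<integral>x. std_normal_density x * h x \<partial>lborel"
  obtains f f' where "\<And>x. (f has_real_derivative f' x) (at x)"
    and "\<And>x. f' x - x * f x = h x - \<kappa>" and "\<And>x. \<bar>f' x\<bar> \<le> 2"
proof -
  have [measurable]: "h \<in> borel_measurable borel" by (rule borel_measurable_continuous_onI[OF cont])
  have ih: "integrable lborel (\<lambda>x. std_normal_density x * h x)"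
    by (rule Bochner_Integration.integrable_bound[OF integrable_std_normal_density])
       (use h in \<open>auto simp: abs_mult mult_left_le\<close>)
  have \<kappa>: "0 \<le> \<kappa>" "\<kappa> \<le> 1"
  proof -
    show "0 \<le> \<kappa>" unfolding \<kappa>_def using h by (intro integral_nonneg_AE) auto
    have "\<kappa> \<le> (\<integral>x. std_normal_density x \<partial>lborel)"
      unfolding \<kappa>_def using h by (intro integral_mono ih integrable_std_normal_density) (auto simp: mult_left_le)
    then show "\<kappa> \<le> 1" by (simp add: integral_std_normal_density)
  qed
  define g where "g = (\<lambda>t. (h t - \<kappa>) * std_normal_density t)"
  have hk: "\<bar>h t - \<kappa>\<bar> \<le> 1" for t using h[of t] \<kappa> by linarith
  have gb: "\<bar>g t\<bar> \<le> std_normal_density t" for t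
    using mult_right_mono[OF hk, of "std_normal_density t"] by (simp add: g_def abs_mult)
  have gc: "continuous_on UNIV g"
    unfolding g_def by (intro continuous_intros cont continuous_std_normal_density)
  have gm [measurable]: "g \<in> borel_measurable borel" by (rule borel_measurable_continuous_onI[OF gc])
  have ig: "integrable lborel g"
    by (rule Bochner_Integration.integrable_bound[OF integrable_std_normal_density]) (use gb in auto)
  have g0: "(\<integral>t. g t \<partial>lborel) = 0"
  proof -
    have "(\<integral>t. g t \<partial>lborel) = (\<integral>t. std_normal_density t * h t - \<kappa> * std_normal_density t \<partial>lborel)"
      by (intro Bochner_Integration.integral_cong refl) (simp add: g_def algebra_simps)
    also have "\<dots> = \<kappa> - \<kappa> * 1"
      using ih integrable_std_normal_density integral_std_normal_density by (simp add: \<kappa>_def)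
    finally show ?thesis by simp
  qed
  define k where "k = (\<lambda>x. \<integral>t. indicator {..x} t * g t \<partial>lborel)"
  have iI: "integrable lborel (\<lambda>t. indicator A t * g t)" if "A \<in> sets borel" for A
    by (rule Bochner_Integration.integrable_bound[OF ig]) (use that in \<open>auto split: split_indicator\<close>)
  obtain G where G: "\<And>x. (G has_real_derivative g x) (at x)"
  proof -
    have "\<exists>F. \<forall>x::real. - \<infinity> < ereal x \<longrightarrow> ereal x < \<infinity> \<longrightarrow> (F has_vector_derivative g x) (at x)"
      by (rule einterval_antiderivative) (use gc in \<open>auto simp: continuous_on_eq_continuous_at\<close>)
    then show ?thesis using that by (auto simp: has_real_derivative_iff_has_vector_derivative)
  qed
  have kG: "k b - k a = G b - G a" if "a \<le> b" for a b
  proof -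
    have "k b - k a = (\<integral>t. indicator {..b} t * g t - indicator {..a} t * g t \<partial>lborel)"
      unfolding k_def by (rule Bochner_Integration.integral_diff[symmetric]) (auto intro: iI)
    also have "\<dots> = (\<integral>t. g t * indicator {a..b} t \<partial>lborel)"
    proof (rule integral_cong_AE)
      show "AE t in lborel. indicator {..b} t * g t - indicator {..a} t * g t = g t * indicator {a..b} t"
        using AE_lborel_singleton[of a] by eventually_elim (use that in \<open>auto split: split_indicator\<close>)
    qed auto
    also have "\<dots> = G b - G a"
      using G that gc by (intro integral_FTC_Icc_real) (auto simp: continuous_on_eq_continuous_at)
    finally show ?thesis .
  qed
  have k_eq: "k x = G x + (k 0 - G 0)" for x
    using kG[of x 0] kG[of 0 x] by linarith
  have dk: "(k has_real_derivative g x) (at x)" for x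
  proof -
    have "((\<lambda>x. G x + (k 0 - G 0)) has_real_derivative g x) (at x)"
      using DERIV_add[OF G DERIV_const] by simp
    moreover have "k = (\<lambda>x. G x + (k 0 - G 0))" using k_eq by blast
    ultimately show ?thesis by simp
  qed
  have kb: "\<bar>x * k x\<bar> \<le> std_normal_density x" for x
  proof (cases "0 \<le> x")
    case True
    have "k x + (\<integral>t. indicator {x..} t * g t \<partial>lborel) = (\<integral>t. indicator {..x} t * g t + indicator {x..} t * g t \<partial>lborel)"
      unfolding k_def by (rule Bochner_Integration.integral_add[symmetric]) (auto intro: iI)
    also have "\<dots> = (\<integral>t. g t \<partial>lborel)"
    proof (rule integral_cong_AE)
      show "AE t in lborel. indicator {..x} t * g t + indicator {x..} t * g t = g t"
        using AE_lborel_singleton[of x] by eventually_elim (auto split: split_indicator)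
    qed auto
    finally have "k x = - (\<integral>t. indicator {x..} t * g t \<partial>lborel)" using g0 by simp
    then show ?thesis using mills_ratio[OF gm gb True] True by (simp add: abs_mult)
  next
    case False
    have "k x = (\<integral>t. indicator {..x} (0 + - 1 * t) * g (0 + - 1 * t) \<partial>lborel)"
      unfolding k_def by (subst lborel_integral_real_affine[of "- 1" _ 0]) auto
    also have "\<dots> = (\<integral>t. indicator {- x..} t * g (- t) \<partial>lborel)"
      by (intro Bochner_Integration.integral_cong refl) (auto split: split_indicator)
    finally have "k x = (\<integral>t. indicator {- x..} t * g (- t) \<partial>lborel)" .
    moreover have "(- x) * \<bar>\<integral>t. indicator {- x..} t * g (- t) \<partial>lborel\<bar> \<le> std_normal_density (- x)"
    proof (rule mills_ratio)
      show "\<bar>g (- t)\<bar> \<le> std_normal_density t" for t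
        using gb[of "- t"] by (simp add: std_normal_density_def)
    qed (use False in auto)
    ultimately show ?thesis using False by (simp add: abs_mult std_normal_density_def)
  qed
  define f where "f = (\<lambda>x. k x / std_normal_density x)"
  have "(f has_real_derivative x * f x + (h x - \<kappa>)) (at x)" for x
  proof -
    have n: "std_normal_density x \<noteq> 0" using std_normal_density_gt_0[of x] by simp
    have "(f has_real_derivative (g x * std_normal_density x - k x * (- x * std_normal_density x)) / (std_normal_density x * std_normal_density x)) (at x)"
      unfolding f_def by (rule DERIV_divide[OF dk std_normal_density_has_derivative n])
    moreover have "(g x * std_normal_density x - k x * (- x * std_normal_density x)) / (std_normal_density x * std_normal_density x) = x * f x + (h x - \<kappa>)"
      using n by (simp add: g_def f_def field_simps)
    ultimately show ?thesis by simp
  qed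
  moreover have "\<bar>x * f x + (h x - \<kappa>)\<bar> \<le> 2" for x
  proof -
    have "\<bar>x * f x\<bar> = \<bar>x * k x\<bar> / std_normal_density x"
      using std_normal_density_gt_0[of x] by (simp add: f_def abs_mult)
    also have "\<dots> \<le> 1" using kb[of x] std_normal_density_gt_0[of x] by simp
    finally show ?thesis using hk[of x] by linarith
  qed
  ultimately show ?thesis
    by (intro that[of f "\<lambda>x. x * f x + (h x - \<kappa>)"]) auto
qed

section \<open>Total variation through continuous test functions\<close>

text \<open>
Choose a compact \<open>K\<close> inside \<open>A\<close> that nearly exhausts it for \<open>\<mu>\<close> and an open \<open>U\<close> around \<open>A\<close> that is nearly tight
for \<open>\<nu>\<close>. A Urysohn function between \<open>K\<close> and \<open>U\<close> is a test function that overestimates the \<open>\<mu>\<close>-measure of \<open>K\<close>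
and underestimates the \<open>\<nu>\<close>-measure of \<open>U\<close>.
\<close>

lemma measure_diff_le_continuous_test:
  fixes \<mu> \<nu> :: "real measure"
  assumes \<mu>: "finite_measure \<mu>" "sets \<mu> = sets borel" and \<nu>: "finite_measure \<nu>" "sets \<nu> = sets borel"
    and test: "\<And>h. continuous_on UNIV h \<Longrightarrow> (\<And>x. 0 \<le> h x) \<Longrightarrow> (\<And>x. h x \<le> 1) \<Longrightarrow>
      (\<integral>x. h x \<partial>\<mu>) - (\<integral>x. h x \<partial>\<nu>) \<le> B"
    and A: "A \<in> sets borel"
  shows "measure \<mu> A - measure \<nu> A \<le> B"
proof (rule field_le_epsilon)
  fix e :: real assume e: "0 < e"
  interpret \<mu>: finite_measure \<mu> by fact
  interpret \<nu>: finite_measure \<nu> by fact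
  have [measurable_cong]: "sets \<mu> = sets borel" "sets \<nu> = sets borel" by fact+
  have "\<exists>K. K \<subseteq> A \<and> compact K \<and> measure \<mu> A - e / 2 < measure \<mu> K"
  proof (rule ccontr)
    assume "\<not> ?thesis"
    then have le: "measure \<mu> K \<le> measure \<mu> A - e / 2" if "K \<subseteq> A" "compact K" for K
      using that by (meson not_le)
    have nn: "0 \<le> measure \<mu> A - e / 2" using le[of "{}"] by simp
    have "emeasure \<mu> A = (SUP K \<in> {K. K \<subseteq> A \<and> compact K}. emeasure \<mu> K)"
      by (rule inner_regular) (use \<mu> A in auto)
    also have "\<dots> \<le> ennreal (measure \<mu> A - e / 2)"
      using le by (intro SUP_least) (auto simp: \<mu>.emeasure_eq_measure ennreal_leI)
    finally show False using e nn by (simp add: \<mu>.emeasure_eq_measure)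
  qed
  then obtain K where K: "K \<subseteq> A" "compact K" "measure \<mu> A - e / 2 < measure \<mu> K" by blast
  have "\<exists>U. A \<subseteq> U \<and> open U \<and> measure \<nu> U < measure \<nu> A + e / 2"
  proof (rule ccontr)
    assume "\<not> ?thesis"
    then have ge: "measure \<nu> A + e / 2 \<le> measure \<nu> U" if "A \<subseteq> U" "open U" for U
      using that by (meson not_le)
    have "ennreal (measure \<nu> A + e / 2) \<le> (INF U \<in> {U. A \<subseteq> U \<and> open U}. emeasure \<nu> U)"
      using ge by (intro INF_greatest) (auto simp: \<nu>.emeasure_eq_measure ennreal_leI)
    also have "\<dots> = emeasure \<nu> A"
      by (rule outer_regular[symmetric]) (use \<nu> A in auto)
    finally show False using e by (simp add: \<nu>.emeasure_eq_measure)
  qed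
  then obtain U where U: "A \<subseteq> U" "open U" "measure \<nu> U < measure \<nu> A + e / 2" by blast
  have KU: "K \<inter> (- U) = {}" using K(1) U(1) by blast
  obtain h :: "real \<Rightarrow> real" where hc: "continuous_on UNIV h" and hs: "\<And>x. h x \<in> closed_segment 1 0"
    and h1: "\<And>x. x \<in> K \<Longrightarrow> h x = 1" and h0: "\<And>x. x \<in> - U \<Longrightarrow> h x = 0"
    using Urysohn[OF compact_imp_closed[OF K(2)] _ KU, of 1 0] U(2) by (auto simp: closed_Compl)
  have h01: "0 \<le> h x" "h x \<le> 1" for x using hs[of x] by (auto simp: closed_segment_eq_real_ivl)
  have [measurable]: "h \<in> borel_measurable borel" by (rule borel_measurable_continuous_onI[OF hc])
  have [measurable]: "K \<in> sets borel" "U \<in> sets borel" using K(2) U(2) by (auto intro: borel_compact)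
  have ih: "integrable \<mu> h" "integrable \<nu> h"
    using h01 by (auto intro!: \<mu>.integrable_const_bound[of _ 1] \<nu>.integrable_const_bound[of _ 1])
  have "measure \<mu> K = (\<integral>x. indicator K x \<partial>\<mu>)" by (simp add: \<mu>(2))
  also have "\<dots> \<le> (\<integral>x. h x \<partial>\<mu>)"
    using h1 h01 ih by (intro integral_mono) (auto split: split_indicator simp: \<mu>.emeasure_finite less_top[symmetric])
  finally have 1: "measure \<mu> K \<le> (\<integral>x. h x \<partial>\<mu>)" .
  have "(\<integral>x. h x \<partial>\<nu>) \<le> (\<integral>x. indicator U x \<partial>\<nu>)"
    using h0 h01 ih by (intro integral_mono) (auto split: split_indicator simp: \<nu>.emeasure_finite less_top[symmetric])
  also have "\<dots> = measure \<nu> U" by (simp add: \<nu>(2))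
  finally have 2: "(\<integral>x. h x \<partial>\<nu>) \<le> measure \<nu> U" .
  show "measure \<mu> A - measure \<nu> A \<le> B + e"
    using test[OF hc h01] 1 2 K(3) U(3) by linarith
qed

section \<open>Normal approximation of a centred potential\<close>

context potential
begin

definition F :: "'a \<Rightarrow> real" where
  "F x = 2 * \<psi> x - (\<integral>y. 2 * \<psi> y \<partial>gauss)"

definition \<sigma>2 :: real where
  "\<sigma>2 = (\<integral>x. (F x)\<^sup>2 \<partial>gauss)"

lemma tame_F: "tame F"
  unfolding F_def by (intro tame_intros tame_psi)

lemmas tame_F' [tame_intros] = tame_compose[OF tame_F]

lemmas tame_T' [tame_intros] = tame_compose[OF tame_T]

lemma F_has_derivative: "(F has_derivative (\<lambda>h. (2 *\<^sub>R R x) \<bullet> h)) (at x)"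
proof -
  have "(F has_derivative (\<lambda>h. 2 * (R x \<bullet> h) - 0)) (at x)"
    unfolding F_def by (intro has_derivative_diff has_derivative_mult_right der has_derivative_const)
  then show ?thesis by simp
qed

text \<open>
The covariance formula for \<open>f \<circ> F\<close> and \<open>2 \<psi>\<close>; the factor 4 comes from the two gradients \<open>2 R\<close>.
\<close>

lemma stein_kernel_identity:
  assumes f: "\<And>y. (f has_real_derivative f' y) (at y)" and tf: "tame f" "tame f'"
  shows "(\<integral>x. f (F x) * F x \<partial>gauss) = (\<integral>x. f' (F x) * (4 * T x) \<partial>gauss)"
proof -
  note [tame_intros] = tame_compose[OF tf(1)] tame_compose[OF tf(2)]
  have d1: "((\<lambda>x. f (F x)) has_derivative (\<lambda>h. (f' (F x) *\<^sub>R (2 *\<^sub>R R x)) \<bullet> h)) (at x)" for x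
  proof -
    have "(f has_derivative (\<lambda>h. f' (F x) * h)) (at (F x))"
      using f[of "F x"] by (simp add: has_field_derivative_def)
    from has_derivative_compose[OF F_has_derivative this] show ?thesis by (simp add: mult.assoc)
  qed
  have d2: "((\<lambda>x. 2 * \<psi> x) has_derivative (\<lambda>h. (2 *\<^sub>R R x) \<bullet> h)) (at x)" for x
    using has_derivative_mult_right[OF der, of 2] by simp
  have "(\<integral>x. f (F x) * F x \<partial>gauss) = (\<integral>x. f (F x) * (2 * \<psi> x - (\<integral>y. 2 * \<psi> y \<partial>gauss)) \<partial>gauss)"
    by (simp only: F_def)
  also have "\<dots> = (\<integral>x. (f' (F x) *\<^sub>R (2 *\<^sub>R R x)) \<bullet> (\<integral>q. 2 *\<^sub>R R (cos (fst q) *\<^sub>R x + sin (fst q) *\<^sub>R snd q) \<partial>arc_measure) \<partial>gauss)"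
    by (rule gauss_covariance[OF d1 d2]) (intro tame_intros tame_psi tame_R tame_F)+
  also have "\<dots> = (\<integral>x. f' (F x) * (4 * T x) \<partial>gauss)"
    by (simp add: T_def V_def mult_ac)
  finally show ?thesis .
qed

lemma expectation_T: "(\<integral>x. 4 * T x \<partial>gauss) = \<sigma>2"
  using stein_kernel_identity[of "\<lambda>y. y" "\<lambda>_. 1"] by (simp add: \<sigma>2_def tame_intros power2_eq_square)

text \<open>
Stein's equation is solved for the rescaled test function \<open>z \<mapsto> h (sqrt \<sigma>2 * z)\<close>, so that the second
integral is the expectation of \<open>h\<close> under the normal law with variance \<open>\<sigma>2\<close>.
\<close>

lemma continuous_test_bound:
  assumes cont: "continuous_on UNIV h" and h: "\<And>x. 0 \<le> h x" "\<And>x. h x \<le> 1" and pos: "0 < \<sigma>2"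
  shows "(\<integral>x. h (F x) \<partial>gauss) - (\<integral>z. std_normal_density z * h (sqrt \<sigma>2 * z) \<partial>lborel) \<le> 16 * sqrt r2 / \<sigma>2"
proof -
  interpret g: prob_space "gauss :: 'a measure" by (rule prob_space_gauss)
  note mg = moment_measure_gauss
  define s where "s = sqrt \<sigma>2"
  have s: "0 < s" "s * s = \<sigma>2" using pos by (auto simp: s_def)
  define \<kappa> where "\<kappa> = (\<integral>z. std_normal_density z * h (s * z) \<partial>lborel)"
  have hsc: "continuous_on UNIV (\<lambda>z. h (s * z))"
    by (intro continuous_on_compose2[OF cont] continuous_intros) auto
  obtain f f' where f: "\<And>x. (f has_real_derivative f' x) (at x)"
    and eq: "\<And>x. f' x - x * f x = h (s * x) - \<kappa>" and f'b: "\<And>x. \<bar>f' x\<bar> \<le> 2"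
    using stein_solution[OF hsc h] unfolding \<kappa>_def by blast
  have tf: "tame f"
  proof (rule tame_lipschitz[of _ 2])
    fix x y :: real
    have "norm (f x - f y) \<le> 2 * norm (x - y)"
      by (rule field_differentiable_bound[of UNIV f f']) (use f f'b in auto)
    then show "norm (f x - f y) \<le> 2 * norm (x - y)" .
  qed
  have f'_eq: "f' = (\<lambda>x. x * f x + (h (s * x) - \<kappa>))" using eq by (auto simp: algebra_simps)
  have tf': "tame f'"
  proof (rule tame_bounded_real[OF _ f'b])
    show "continuous_on UNIV f'"
      unfolding f'_eq by (intro continuous_intros hsc tame_continuous[OF tf])
  qed
  have th: "tame h" by (rule tame_bounded_real[OF cont, of 1]) (use h in auto)
  note [tame_intros] = tame_compose[OF tf] tame_compose[OF tf'] tame_compose[OF th]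
  define e where "e = (\<lambda>x. \<sigma>2 - 4 * T x)"
  have te [tame_intros]: "tame e" unfolding e_def by (intro tame_intros tame_T)
  note [tame_intros] = tame_compose[OF te]
  have id: "(\<integral>x. s * f (F x / s) * F x \<partial>gauss) = (\<integral>x. f' (F x / s) * (4 * T x) \<partial>gauss)"
  proof (rule stein_kernel_identity)
    fix y
    have "((\<lambda>y. f (y / s)) has_real_derivative f' (y / s) * (1 / s)) (at y)"
      by (rule DERIV_chain2[OF f]) (use s(1) in \<open>auto intro!: derivative_eq_intros\<close>)
    from DERIV_cmult[OF this, of s] show "((\<lambda>y. s * f (y / s)) has_real_derivative f' (y / s)) (at y)"
      using s by simp
  qed (intro tame_intros)+
  have sk: "(\<integral>x. (F x / s) * f (F x / s) \<partial>gauss) = (\<integral>x. f' (F x / s) * (4 * T x) \<partial>gauss) / \<sigma>2"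
  proof -
    have "(F x / s) * f (F x / s) = (s * f (F x / s) * F x) / \<sigma>2" for x
      unfolding s(2)[symmetric] using s(1) by simp
    then have "(\<integral>x. (F x / s) * f (F x / s) \<partial>gauss) = (\<integral>x. s * f (F x / s) * F x \<partial>gauss) / \<sigma>2"
      by simp
    then show ?thesis by (simp only: id)
  qed
  have "(\<integral>x. h (F x) \<partial>gauss) - \<kappa> = (\<integral>x. h (F x) - \<kappa> \<partial>gauss)"
    using g.prob_space by (subst Bochner_Integration.integral_diff) (auto intro!: tame_integrable[OF mg] tame_intros tame_F)
  also have "\<dots> = (\<integral>x. f' (F x / s) - (F x / s) * f (F x / s) \<partial>gauss)"
    using s eq[of "F x / s" for x] by simp
  also have "\<dots> = (\<integral>x. f' (F x / s) \<partial>gauss) - (\<integral>x. f' (F x / s) * (4 * T x) \<partial>gauss) / \<sigma>2"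
    by (subst Bochner_Integration.integral_diff) (auto intro!: tame_integrable[OF mg] tame_intros tame_F simp only: sk)
  also have "\<dots> = (\<integral>x. f' (F x / s) * e x \<partial>gauss) / \<sigma>2"
  proof -
    have "(\<integral>x. f' (F x / s) * e x \<partial>gauss) = (\<integral>x. \<sigma>2 * f' (F x / s) - f' (F x / s) * (4 * T x) \<partial>gauss)"
      by (intro Bochner_Integration.integral_cong refl) (simp add: e_def algebra_simps)
    also have "\<dots> = \<sigma>2 * (\<integral>x. f' (F x / s) \<partial>gauss) - (\<integral>x. f' (F x / s) * (4 * T x) \<partial>gauss)"
      by (subst Bochner_Integration.integral_diff) (auto intro!: tame_integrable[OF mg] tame_intros tame_F tame_T)
    finally show ?thesis using pos by (simp add: field_simps)
  qed
  also have "\<dots> \<le> (\<integral>x. 2 * \<bar>e x\<bar> \<partial>gauss) / \<sigma>2"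
  proof (intro divide_right_mono integral_tame_mono[OF mg])
    fix x
    have "f' (F x / s) * e x \<le> \<bar>f' (F x / s)\<bar> * \<bar>e x\<bar>" by (metis abs_ge_self abs_mult)
    also have "\<dots> \<le> 2 * \<bar>e x\<bar>" using f'b by (intro mult_right_mono) auto
    finally show "f' (F x / s) * e x \<le> 2 * \<bar>e x\<bar>" .
  qed (use pos in \<open>auto intro!: tame_intros tame_F\<close>)
  also have "\<dots> \<le> 16 * sqrt r2 / \<sigma>2"
  proof (intro divide_right_mono)
    have m: "\<sigma>2 = 4 * (\<integral>y. T y \<partial>gauss)" using expectation_T by simp
    have "(\<integral>x. \<bar>e x\<bar> \<partial>gauss)\<^sup>2 \<le> 1 * (\<integral>x. \<bar>e x\<bar>\<^sup>2 \<partial>gauss)"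
      by (rule square_integral_le[OF mg]) (use g.prob_space in \<open>auto intro!: tame_intros\<close>)
    also have "\<dots> = (\<integral>x. 16 * (T x - (\<integral>y. T y \<partial>gauss))\<^sup>2 \<partial>gauss)"
      unfolding e_def m mult_1 power2_abs
      by (intro Bochner_Integration.integral_cong refl) (simp add: power2_eq_square algebra_simps)
    also have "\<dots> \<le> 64 * r2" using T_variance by simp
    also have "\<dots> = (8 * sqrt r2)\<^sup>2" using r2_nonneg by (simp add: power_mult_distrib)
    finally have "(\<integral>x. \<bar>e x\<bar> \<partial>gauss)\<^sup>2 \<le> (8 * sqrt r2)\<^sup>2" .
    from power2_le_imp_le[OF this] have "(\<integral>x. \<bar>e x\<bar> \<partial>gauss) \<le> 8 * sqrt r2"
      using r2_nonneg by simp
    then show "(\<integral>x. 2 * \<bar>e x\<bar> \<partial>gauss) \<le> 16 * sqrt r2" by simp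
  qed (use pos in simp)
  finally show ?thesis by (simp add: \<kappa>_def s_def)
qed

end

section \<open>The squared distance to a convex set\<close>

lemma infdist_eq_dist_closest_point:
  assumes "closed C" "C \<noteq> {}"
  shows "infdist x C = norm (x - closest_point C x)"
  using setdist_closest_point[OF assms, of x] assms(2) by (simp add: infdist_eq_setdist dist_norm)

text \<open>
The sum of the variational inequalities of the two projections.
\<close>

lemma closest_point_monotone:
  assumes "closed C" "convex C" "C \<noteq> {}"
  shows "(norm (closest_point C x - closest_point C y))\<^sup>2 \<le> (closest_point C x - closest_point C y) \<bullet> (x - y)"
proof -
  have "(x - closest_point C x) \<bullet> (closest_point C y - closest_point C x) \<le> 0"
       "(y - closest_point C y) \<bullet> (closest_point C x - closest_point C y) \<le> 0"
    using assms by (auto intro!: closest_point_dot closest_point_in_set)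
  then show ?thesis
    unfolding power2_norm_eq_inner by (simp add: inner_simps inner_commute)
qed

text \<open>
That the residual is nonexpansive follows from \<open>closest_point_monotone\<close>. For the quadratic bound, comparing
\<open>y + \<mu>\<close> with the projection of \<open>x + \<mu>\<close> bounds the error from above; the lower bound is the upper one with
\<open>x\<close> and \<open>y\<close> exchanged, up to a term controlled by the Lipschitz property.
\<close>

lemma potential_half_dist_square:
  fixes C :: "'a::euclidean_space set"
  assumes C: "closed C" "convex C" "C \<noteq> {}"
  shows "potential (\<lambda>x. (infdist (x + \<mu>) C)\<^sup>2 / 2) (\<lambda>x. x + \<mu> - closest_point C (x + \<mu>))"
proof
  let ?P = "\<lambda>x. closest_point C (x + \<mu>)" and ?R = "\<lambda>x. x + \<mu> - closest_point C (x + \<mu>)"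
  fix x y
  show lip: "norm (?R x - ?R y) \<le> norm (x - y)" for x y
  proof (rule power2_le_imp_le)
    define p where "p = ?P x - ?P y"
    have "(norm p)\<^sup>2 \<le> p \<bullet> (x - y)"
      using closest_point_monotone[OF C, of "x + \<mu>" "y + \<mu>"] by (simp add: p_def)
    moreover have "(norm (?R x - ?R y))\<^sup>2 = (norm (x - y))\<^sup>2 - 2 * (p \<bullet> (x - y)) + (norm p)\<^sup>2"
    proof -
      have "(norm (d - p))\<^sup>2 = (norm d)\<^sup>2 - 2 * (p \<bullet> d) + (norm p)\<^sup>2" for d
        by (simp add: power2_norm_eq_inner inner_simps inner_commute)
      moreover have "?R x - ?R y = (x - y) - p" by (simp add: p_def)
      ultimately show ?thesis by (simp only:)
    qed
    moreover have "0 \<le> (norm p)\<^sup>2" by simp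
    ultimately show "(norm (?R x - ?R y))\<^sup>2 \<le> (norm (x - y))\<^sup>2" by linarith
  qed simp
  have upper: "(infdist (y + \<mu>) C)\<^sup>2 / 2 - (infdist (x + \<mu>) C)\<^sup>2 / 2 - ?R x \<bullet> (y - x) \<le> (norm (y - x))\<^sup>2 / 2" for x y
  proof -
    have "infdist (y + \<mu>) C \<le> norm (y + \<mu> - ?P x)"
      using infdist_le[OF closest_point_in_set[OF C(1,3)], of "y + \<mu>" "x + \<mu>"] by (simp add: dist_norm)
    then have "(infdist (y + \<mu>) C)\<^sup>2 \<le> (norm (y + \<mu> - ?P x))\<^sup>2" by (intro power_mono) (auto simp: infdist_nonneg)
    moreover have "(norm (y + \<mu> - ?P x))\<^sup>2 = (norm (?R x))\<^sup>2 + 2 * (?R x \<bullet> (y - x)) + (norm (y - x))\<^sup>2"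
    proof -
      have "y + \<mu> - ?P x = ?R x + (y - x)" by simp
      then show ?thesis by (simp only: power2_norm_eq_inner inner_add_left inner_add_right inner_commute[of "y - x" "?R x"])
    qed
    ultimately show ?thesis by (simp add: infdist_eq_dist_closest_point[OF C(1,3)])
  qed
  have "?R y \<bullet> (x - y) + ?R x \<bullet> (y - x) = - ((?R y - ?R x) \<bullet> (y - x))" by (simp add: inner_simps)
  moreover have "\<bar>(?R y - ?R x) \<bullet> (y - x)\<bar> \<le> (norm (y - x))\<^sup>2"
  proof -
    have "\<bar>(?R y - ?R x) \<bullet> (y - x)\<bar> \<le> norm (?R y - ?R x) * norm (y - x)" by (rule Cauchy_Schwarz_ineq2)
    also have "\<dots> \<le> norm (y - x) * norm (y - x)" using lip by (intro mult_right_mono) auto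
    finally show ?thesis by (simp add: power2_eq_square)
  qed
  moreover have "0 \<le> (norm (y - x))\<^sup>2" by simp
  ultimately show "\<bar>(infdist (y + \<mu>) C)\<^sup>2 / 2 - (infdist (x + \<mu>) C)\<^sup>2 / 2 - ?R x \<bullet> (y - x)\<bar> \<le> 2 * (norm (y - x))\<^sup>2"
    using upper[of x y] upper[of y x] norm_minus_commute[of x y] by (simp add: abs_le_iff)
qed

lemma infdist_translation: "infdist x ((\<lambda>y. y - \<mu>) ` C) = infdist (x + \<mu>) (C :: 'a::real_normed_vector set)"
proof -
  have "dist x (y - \<mu>) = dist (x + \<mu>) y" for y by (simp add: dist_norm algebra_simps)
  then show ?thesis by (simp add: infdist_def image_image)
qed

lemma distr_std_gaussian_vector:
  fixes g :: "'a \<Rightarrow> real ^ 'd"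
  assumes "std_gaussian_vector M g"
  shows "g \<in> measurable M borel" "distr M borel g = gauss"
proof -
  have "(\<Prod>i\<in>UNIV. std_normal_density (x $ i)) = gauss_density x" for x :: "real ^ 'd"
  proof -
    have "(norm x)\<^sup>2 = (\<Sum>i\<in>UNIV. (x $ i)\<^sup>2)"
      by (simp add: norm_vec_def L2_set_def sum_nonneg)
    then show ?thesis
      by (simp add: gauss_density_def std_normal_density_def prod.distrib power_divide prod_dividef
          exp_sum[symmetric] sum_negf sum_divide_distrib)
  qed
  then have "distributed M lborel g (\<lambda>x. ennreal (gauss_density x))"
    using assms by (simp add: std_gaussian_vector_def)
  then show "g \<in> measurable M borel" "distr M borel g = gauss"
    by (auto simp: distributed_def gauss_def cong: distr_cong)
qed

theorem theorem2p1:
  fixes C :: "(real ^ 'd) set" and \<mu> :: "real ^ 'd"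
    and M :: "'a measure" and g :: "'a \<Rightarrow> real ^ 'd" and F :: "'a \<Rightarrow> real" and \<sigma>2 :: real
    and M' :: "'b measure" and N :: "'b \<Rightarrow> real"
  assumes "closed C" and "convex C" and "C \<noteq> {}" and "C \<noteq> UNIV"
    and "prob_space M" and "std_gaussian_vector M g"
    and "F = (\<lambda>\<omega>. (infdist (g \<omega> + \<mu>) C)\<^sup>2
                - prob_space.expectation M (\<lambda>\<omega>. (infdist (g \<omega> + \<mu>) C)\<^sup>2))"
    and "\<sigma>2 = prob_space.variance M F"
    and "prob_space M'" and "distributed M' lborel N (\<lambda>x. ennreal (normal_density 0 (sqrt \<sigma>2) x))"
  shows "tv_dist M F M' N
    \<le> 16 * sqrt (prob_space.expectation M (\<lambda>\<omega>. (infdist (g \<omega>) ((\<lambda>y. y - \<mu>) ` C))\<^sup>2)) / \<sigma>2"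
proof -
  interpret M: prob_space M by fact
  interpret M': prob_space M' by fact
  interpret g: prob_space "gauss :: (real ^ 'd) measure" by (rule prob_space_gauss)
  interpret p: potential "\<lambda>x. (infdist (x + \<mu>) C)\<^sup>2 / 2" "\<lambda>x. x + \<mu> - closest_point C (x + \<mu>)"
    by (rule potential_half_dist_square) fact+
  note gm [measurable] = distr_std_gaussian_vector(1)[OF assms(6)]
  have gauss: "(\<integral>\<omega>. u (g \<omega>) \<partial>M) = (\<integral>x. u x \<partial>gauss)" if "tame u" for u :: "real ^ 'd \<Rightarrow> real"
    using integral_distr[OF gm borel_measurable_continuous_onI[OF tame_continuous[OF that]]]
    by (simp add: distr_std_gaussian_vector(2)[OF assms(6)])
  have tp: "tame (\<lambda>x. (infdist (x + \<mu>) C)\<^sup>2)"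
    using tame_mult[OF tame_const[of 2] p.tame_psi] by simp
  have F_eq: "F \<omega> = p.F (g \<omega>)" for \<omega>
    unfolding assms(7) p.F_def using gauss[OF tp] by simp
  have F0: "M.expectation F = 0"
  proof -
    have "M.expectation F = (\<integral>x. p.F x \<partial>gauss)" using gauss[OF p.tame_F] by (simp add: F_eq[abs_def])
    also have "\<dots> = 0"
      unfolding p.F_def using tame_integrable[OF moment_measure_gauss tp] g.prob_space by simp
    finally show ?thesis .
  qed
  have \<sigma>2: "\<sigma>2 = p.\<sigma>2"
    unfolding assms(8) F0 p.\<sigma>2_def using gauss[OF tame_power[OF p.tame_F, of 2]] by (simp add: F_eq)
  \<comment> \<open>For standard deviation 0 the function \<open>normal_density\<close> is identically 0, so it is not the
      density of a random variable.\<close>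
  have pos: "0 < \<sigma>2"
  proof (rule ccontr)
    assume "\<not> 0 < \<sigma>2"
    moreover have "0 \<le> \<sigma>2" unfolding \<sigma>2 p.\<sigma>2_def by simp
    ultimately have "\<sigma>2 = 0" by simp
    then have "distr M' lborel N = density lborel (\<lambda>x. 0)"
      using assms(10) by (simp add: distributed_def normal_density_def)
    moreover have "prob_space (distr M' lborel N)"
      using assms(10) by (intro M'.prob_space_distr) (simp add: distributed_def)
    ultimately show False
      using prob_space.emeasure_space_1 by (fastforce simp: emeasure_density)
  qed
  have r2: "p.r2 = M.expectation (\<lambda>\<omega>. (infdist (g \<omega>) ((\<lambda>y. y - \<mu>) ` C))\<^sup>2)"
    unfolding p.r2_def using gauss[OF tp] assms(1,3)
    by (simp add: infdist_translation infdist_eq_dist_closest_point)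
  let ?B = "16 * sqrt p.r2 / \<sigma>2"
  have Fm [measurable]: "F \<in> borel_measurable M"
    using measurable_compose[OF gm borel_measurable_continuous_onI[OF tame_continuous[OF p.tame_F]]]
    by (simp add: F_eq[abs_def])
  have Nm [measurable]: "N \<in> borel_measurable M'" using assms(10) by (simp add: distributed_def)
  let ?\<mu> = "distr M borel F" and ?\<nu> = "distr M' borel N"
  interpret \<mu>: prob_space ?\<mu> by (rule M.prob_space_distr) simp
  interpret \<nu>: prob_space ?\<nu> by (rule M'.prob_space_distr) simp
  have normal: "(\<integral>x. h x \<partial>?\<nu>) = (\<integral>z. std_normal_density z * h (sqrt \<sigma>2 * z) \<partial>lborel)"
    if [measurable]: "h \<in> borel_measurable borel" for h :: "real \<Rightarrow> real"
  proof -
    have s: "0 < sqrt \<sigma>2" using pos by simp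
    have "distributed M' lborel (\<lambda>x. (N x - 0) / sqrt \<sigma>2) std_normal_density"
      using M'.normal_standard_normal_convert[OF s, of N 0] assms(10) by simp
    then have "(\<integral>z. std_normal_density z * h (sqrt \<sigma>2 * z) \<partial>lborel) = (\<integral>\<omega>. h (sqrt \<sigma>2 * ((N \<omega> - 0) / sqrt \<sigma>2)) \<partial>M')"
      by (rule distributed_integral) auto
    also have "\<dots> = (\<integral>x. h x \<partial>?\<nu>)" using s by (simp add: integral_distr)
    finally show ?thesis ..
  qed
  have test: "(\<integral>x. h x \<partial>?\<mu>) - (\<integral>x. h x \<partial>?\<nu>) \<le> ?B"
    if h: "continuous_on UNIV h" "\<And>x. 0 \<le> h x" "\<And>x. h x \<le> 1" for h :: "real \<Rightarrow> real"
  proof -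
    have [measurable]: "h \<in> borel_measurable borel" by (rule borel_measurable_continuous_onI[OF h(1)])
    have "tame h" by (rule tame_bounded_real[OF h(1), of 1]) (use h in auto)
    from gauss[OF tame_compose[OF this p.tame_F]]
    have "(\<integral>x. h x \<partial>?\<mu>) = (\<integral>x. h (p.F x) \<partial>gauss)" by (simp add: integral_distr F_eq)
    then show ?thesis
      using p.continuous_test_bound[OF h] pos by (simp add: normal \<sigma>2)
  qed
  have le: "measure ?\<mu> A - measure ?\<nu> A \<le> ?B" if "A \<in> sets borel" for A
    by (rule measure_diff_le_continuous_test[OF _ _ _ _ test that]) (auto intro: \<mu>.finite_measure_axioms \<nu>.finite_measure_axioms)
  \<comment> \<open>The reverse inequality is the same one for the complement of \<open>A\<close>.\<close>
  have "\<bar>measure M {\<omega> \<in> space M. F \<omega> \<in> A} - measure M' {\<omega> \<in> space M'. N \<omega> \<in> A}\<bar> \<le> ?B"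
    if A: "A \<in> sets borel" for A
  proof -
    have m: "measure M {\<omega> \<in> space M. F \<omega> \<in> A} = measure ?\<mu> A" "measure M' {\<omega> \<in> space M'. N \<omega> \<in> A} = measure ?\<nu> A"
      using A by (auto simp: measure_distr vimage_def Int_def conj_commute intro!: arg_cong2[where f = measure])
    have "measure ?\<mu> (- A) = 1 - measure ?\<mu> A" "measure ?\<nu> (- A) = 1 - measure ?\<nu> A"
      using \<mu>.prob_compl[of A] \<nu>.prob_compl[of A] A by (simp_all add: Compl_eq_Diff_UNIV)
    moreover have "- A \<in> sets borel" using A by (simp add: borel_comp)
    ultimately show ?thesis using le[OF A] le[of "- A"] unfolding m by (simp add: abs_le_iff)
  qed
  then show ?thesis
    unfolding tv_dist_def r2[symmetric] by (intro cSUP_least) auto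
qed

end
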